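(* Let $\mathbb G$, $d$, $\phi$, $\mathcal V$ be as in the context. Assume $x_0\in\mathbb R^q\setminus\{0\}$ and $\theta_0\in\mathcal V$, and define the curve $\gamma(s)=(x(s),t(s))$, $0\le s\le1$, by $$x(s)=\frac{\sin(sU(\theta_0))}{\sin U(\theta_0)}e^{(s-1)\widetilde U(\theta_0)}x_0,\qquad t(s)=\frac12\int_0^s\langle\mathbb U x(r),\zeta(r)\rangle\,dr,\qquad \zeta(s)=\frac{U(\theta_0)}{\sin U(\theta_0)}e^{(2s-1)\widetilde U(\theta_0)}x_0 .$$ If $\theta_0$ is a critical point of $\phi(g_0;\cdot)$ for some $g_0=(x_0,t_0)$, then $\gamma$ is a horizontal curve with $\gamma(0)=o$ and $\gamma(1)=g_0$, and $$d(g_0)^2\le\ell(\gamma)^2=\Big|\frac{U(\theta_0)}{\sin U(\theta_0)}x_0\Big|^2=\phi(g_0;\theta_0).$$ Conversely, with $t_0=t(1)$ and $g_0=(x_0,t_0)$, $\theta_0$ is a critical point of $\phi(g_0;\cdot)$.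
   Context: Let $q,m\ge1$, $U^{(1)},\dots,U^{(m)}$ linearly independent real skew-symmetric $q\times q$ matrices; $\mathbb G=\mathbb R^q\times\mathbb R^m$ with law $(x,t)\cdot(x',t')=(x+x',t+t'+\frac12\langle\mathbb Ux,x'\rangle)$, $\langle\mathbb Ux,x'\rangle=(\langle U^{(j)}x,x'\rangle)_{j}$, identity $o$. A horizontal curve is an absolutely continuous $(x(s),t(s))$ with $t'=\frac12\langle\mathbb Ux,x'\rangle$; its length is $\ell=\int_0^1|x'(s)|ds$, and $d(g)$ is the infimum of lengths of horizontal curves from $o$ to $g$ (Carnot–Carathéodory distance). $\widetilde U(\tau)=\sum_j\tau_jU^{(j)}$, $U(\tau)=i\widetilde U(\tau)$. $\mathcal V=\{\vartheta\in\mathbb R^m:\det(k\pi\mathbb I_q-U(\vartheta))\ne0\ \forall k\in\mathbb N^*\}$. For $\vartheta$ in $\mathcal V$ (so that no eigenvalue of $U(\vartheta)$ lies in $\pi\mathbb Z\setminus\{0\}$), $\phi((x,t);\vartheta)=\langle U(\vartheta)\cot U(\vartheta)x,x\rangle+4t\cdot\vartheta$, which is smooth near $\vartheta$. Matrix functions are defined by functional calculus, with the convention $\frac{\sin(s\cdot0)}{\sin0}=s$ and $\frac{0}{\sin0}=1$. *)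

theory Defs
  imports "HOL-Analysis.Analysis"
begin

text \<open>Absolute continuity of a function on an interval [a,b] (classical epsilon-delta definition).\<close>
definition abs_cont_on :: "real \<Rightarrow> real \<Rightarrow> (real \<Rightarrow> 'b::metric_space) \<Rightarrow> bool" where
  "abs_cont_on a b f \<longleftrightarrow>
     (\<forall>e>0. \<exists>d>0. \<forall>(n::nat) (l::nat \<Rightarrow> real) (r::nat \<Rightarrow> real).
        (\<forall>i<n. a \<le> l i \<and> l i \<le> r i \<and> r i \<le> b) \<and>
        (\<forall>i<n. \<forall>j<n. i \<noteq> j \<longrightarrow> r i \<le> l j \<or> r j \<le> l i) \<and>
        (\<Sum>i<n. r i - l i) < d
        \<longrightarrow> (\<Sum>i<n. dist (f (r i)) (f (l i))) < e)"

text \<open>The vector \<open>\<langle>\<UU> x, x'\<rangle> = (\<langle>U^(j) x, x'\<rangle>)_j\<close>.\<close>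
definition UU :: "('m \<Rightarrow> real^'q^'q) \<Rightarrow> real^'q \<Rightarrow> real^'q \<Rightarrow> real^'m" where
  "UU Us x x' = (\<chi> j. (Us j *v x) \<bullet> x')"

text \<open>Group law on \<open>\<real>^q \<times> \<real>^m\<close>.\<close>
definition gmult :: "('m \<Rightarrow> real^'q^'q) \<Rightarrow> ((real^'q) \<times> (real^'m)) \<Rightarrow> ((real^'q) \<times> (real^'m)) \<Rightarrow> ((real^'q) \<times> (real^'m))" where
  "gmult Us g g' = (fst g + fst g', snd g + snd g' + (1/2) *\<^sub>R UU Us (fst g) (fst g'))"

text \<open>Horizontal curves on [0,1].\<close>
definition horizontal :: "('m \<Rightarrow> real^'q^'q) \<Rightarrow> (real \<Rightarrow> (real^'q) \<times> (real^'m)) \<Rightarrow> bool" where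
  "horizontal Us \<gamma> \<longleftrightarrow> abs_cont_on 0 1 \<gamma> \<and>
     (AE s in lborel. s \<in> {0..1} \<longrightarrow>
        (\<exists>x' t'. ((\<lambda>r. fst (\<gamma> r)) has_vector_derivative x') (at s within {0..1}) \<and>
                 ((\<lambda>r. snd (\<gamma> r)) has_vector_derivative t') (at s within {0..1}) \<and>
                 t' = (1/2) *\<^sub>R UU Us (fst (\<gamma> s)) x'))"

definition curve_length :: "(real \<Rightarrow> (real^'q) \<times> (real^'m)) \<Rightarrow> real" where
  "curve_length \<gamma> = integral {0..1} (\<lambda>s. norm (vector_derivative (\<lambda>r. fst (\<gamma> r)) (at s within {0..1})))"

text \<open>Carnot--Caratheodory distance from the identity \<open>o = (0,0)\<close>.\<close>
definition cc_dist :: "('m \<Rightarrow> real^'q^'q) \<Rightarrow> (real^'q) \<times> (real^'m) \<Rightarrow> real" where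
  "cc_dist Us g = Inf {curve_length \<gamma> | \<gamma>. horizontal Us \<gamma> \<and> \<gamma> 0 = (0, 0) \<and> \<gamma> 1 = g}"

text \<open>\<open>\<tilde>U(\<tau>) = \<Sum>_j \<tau>_j U^(j)\<close> and \<open>U(\<tau>) = i \<tilde>U(\<tau>)\<close> (complex matrix).\<close>
definition Ut :: "('m::finite \<Rightarrow> real^'q^'q) \<Rightarrow> real^'m \<Rightarrow> real^'q^'q" where
  "Ut Us \<tau> = (\<Sum>j\<in>UNIV. (\<tau> $ j) *\<^sub>R Us j)"

definition cvec :: "real^'n \<Rightarrow> complex^'n" where
  "cvec x = (\<chi> i. complex_of_real (x $ i))"

definition rvec :: "complex^'n \<Rightarrow> real^'n" where
  "rvec z = (\<chi> i. Re (z $ i))"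

definition cmat :: "real^'n^'m \<Rightarrow> complex^'n^'m" where
  "cmat A = (\<chi> i j. complex_of_real (A $ i $ j))"

definition Uc :: "('m::finite \<Rightarrow> real^'q^'q) \<Rightarrow> real^'m \<Rightarrow> complex^'q^'q" where
  "Uc Us \<tau> = (\<chi> i j. \<i> * (cmat (Ut Us \<tau>) $ i $ j))"

text \<open>Functional calculus for a diagonalizable (e.g. Hermitian) matrix: the matrix acting as
  multiplication by \<open>f \<lambda>\<close> on each eigenvector with eigenvalue \<open>\<lambda>\<close>.\<close>
definition mat_fun :: "(complex \<Rightarrow> complex) \<Rightarrow> complex^'n^'n \<Rightarrow> complex^'n^'n" where
  "mat_fun f A = (THE M. \<forall>v c. A *v v = c *s v \<longrightarrow> M *v v = f c *s v)"

text \<open>Scalar functions with the stated conventions at 0.\<close>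
definition sin_ratio :: "real \<Rightarrow> complex \<Rightarrow> complex" where   (* sin(s z)/sin z *)
  "sin_ratio s z = (if z = 0 then complex_of_real s else sin (complex_of_real s * z) / sin z)"

definition z_over_sin :: "complex \<Rightarrow> complex" where   (* z / sin z *)
  "z_over_sin z = (if z = 0 then 1 else z / sin z)"

definition z_cot :: "complex \<Rightarrow> complex" where   (* z cot z *)
  "z_cot z = (if z = 0 then 1 else z * cos z / sin z)"

text \<open>Applying \<open>f(U(\<theta>))\<close> to a real vector (result is real; we take real parts).\<close>
definition Uapply :: "('m::finite \<Rightarrow> real^'q^'q) \<Rightarrow> (complex \<Rightarrow> complex) \<Rightarrow> real^'m \<Rightarrow> real^'q \<Rightarrow> real^'q" where
  "Uapply Us f \<theta> x = rvec (mat_fun f (Uc Us \<theta>) *v cvec x)"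

text \<open>Real matrix exponential via its power series.\<close>
definition mexp :: "real^'n^'n \<Rightarrow> real^'n^'n" where
  "mexp A = (\<Sum>k. (1 / fact k) *\<^sub>R ((((**) A) ^^ k) (mat 1)))"

definition calV :: "('m::finite \<Rightarrow> real^'q^'q) \<Rightarrow> (real^'m) set" where
  "calV Us = {\<theta>. \<forall>k::nat. k \<ge> 1 \<longrightarrow> det (mat (complex_of_real (real k * pi)) - Uc Us \<theta>) \<noteq> 0}"

definition phi :: "('m::finite \<Rightarrow> real^'q^'q) \<Rightarrow> (real^'q) \<times> (real^'m) \<Rightarrow> real^'m \<Rightarrow> real" where
  "phi Us g \<theta> = Uapply Us z_cot \<theta> (fst g) \<bullet> fst g + 4 * (snd g \<bullet> \<theta>)"

end

theory Submission
  imports Defs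
begin

text \<open>
  A real skew-symmetric \<open>A\<close> rotates: \<open>\<real>\<^sup>q\<close> is spanned by vectors \<open>a\<close> having a partner \<open>b\<close>
  with \<open>A a = c b\<close> and \<open>A b = - c a\<close>. On such a pair an even function of \<open>i A\<close> acts as the
  scalar \<open>f c\<close>, so all formulas for the curve reduce to trigonometric identities: \<open>x' = \<zeta>\<close>,
  \<open>\<zeta>' = 2 A \<zeta>\<close>, \<open>x 0 = 0\<close>, \<open>x 1 = x\<^sub>0\<close> and \<open>\<zeta> 1 = (U cot U) x\<^sub>0 + A x\<^sub>0\<close>.

  For the derivative of \<open>\<phi>\<close>, let \<open>y\<close> and \<open>z\<close> be the curves of the parameters \<open>\<theta>\<^sub>0\<close> and \<open>\<theta>\<close>,
  with the same end points. Integrating by parts, the first terms of \<open>\<phi>\<close> at \<open>\<theta>\<close> and \<open>\<theta>\<^sub>0\<close>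
  differ by \<open>2 \<integral> \<langle>z, (A(\<theta>) - A(\<theta>\<^sub>0)) y'\<rangle>\<close>. Hence mere uniform convergence \<open>z \<rightarrow> y\<close> gives
  the gradient \<open>4 (t\<^sub>0 - t 1)\<close>. The convergence holds because \<open>v \<mapsto> \<integral> exp (2 s A) v\<close> is
  injective when \<open>\<theta>\<^sub>0 \<in> \<V>\<close> and depends continuously on \<open>A\<close>, which also shows that
  parameters near \<open>\<theta>\<^sub>0\<close> have no eigenvalue in \<open>\<pi>\<int> - {0}\<close>.
\<close>

section \<open>Orthonormal eigenbases and rotation pairs\<close>


text \<open>Variational argument: the quadratic form of \<open>T\<close> attains its maximum on the
  compact unit sphere of \<open>S\<close>, and a maximiser must be an eigenvector, since otherwise
  moving along the residual \<open>T e - l *\<^sub>R e\<close> would increase the quotient.\<close>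

lemma symmetric_eigenvector_in_invariant_subspace:
  fixes T :: "'a::euclidean_space \<Rightarrow> 'a"
  assumes T: "linear T" and sym: "\<And>x y. T x \<bullet> y = x \<bullet> T y"
    and S: "subspace S" and inv: "\<And>x. x \<in> S \<Longrightarrow> T x \<in> S" and ne: "x1 \<in> S" "x1 \<noteq> 0"
  obtains e l where "e \<in> S" "norm e = 1" "T e = l *\<^sub>R e"
proof -
  let ?K = "S \<inter> sphere 0 1"
  have "compact ?K"
    by (simp add: S closed_subspace closed_Int_compact)
  moreover have "(1 / norm x1) *\<^sub>R x1 \<in> ?K"
    using ne S by (simp add: subspace_scale)
  then have "?K \<noteq> {}" by blast
  moreover have "continuous_on ?K (\<lambda>x. T x \<bullet> x)"
    using T by (intro continuous_intros linear_continuous_on linear_conv_bounded_linear[THEN iffD1])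
  ultimately obtain e where e: "e \<in> ?K" and emax: "\<And>x. x \<in> ?K \<Longrightarrow> T x \<bullet> x \<le> T e \<bullet> e"
    using continuous_attains_sup[of ?K "\<lambda>x. T x \<bullet> x"] by blast
  define l where "l = T e \<bullet> e"
  have le: "T x \<bullet> x \<le> l * (x \<bullet> x)" if "x \<in> S" for x
  proof (cases "x = 0")
    case True then show ?thesis using T by (simp add: linear_0)
  next
    case False
    let ?y = "(1 / norm x) *\<^sub>R x"
    have "?y \<in> ?K" using that False S by (simp add: subspace_scale)
    from emax[OF this] have "T ?y \<bullet> ?y \<le> l" by (simp add: l_def)
    also have "T ?y \<bullet> ?y = (T x \<bullet> x) / (x \<bullet> x)"
      using T False by (simp add: linear_cmul dot_square_norm power2_eq_square)
    finally show ?thesis using False by (simp add: divide_simps)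
  qed
  have eS: "e \<in> S" and en: "norm e = 1" and ee: "e \<bullet> e = 1"
    using e by (auto simp: dot_square_norm)
  define v where "v = T e - l *\<^sub>R e"
  have vS: "v \<in> S" unfolding v_def using S inv eS by (simp add: subspace_diff subspace_scale)
  have ve: "v \<bullet> e = 0" by (simp add: v_def inner_diff_left ee l_def)
  then have Tev: "T e \<bullet> v = v \<bullet> v"
    by (simp add: v_def inner_diff_left inner_diff_right inner_commute)
  define k where "k = l * (v \<bullet> v) - T v \<bullet> v"
  \<comment> \<open>Maximality tested at \<open>e + t *\<^sub>R v\<close>: a term linear in
    \<open>t\<close> is dominated by a quadratic one, which for small \<open>t\<close> forces
    \<open>v\<close> to vanish.\<close>
  have quad: "2 * t * (v \<bullet> v) \<le> t\<^sup>2 * k" for t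
  proof -
    have "T (e + t *\<^sub>R v) \<bullet> (e + t *\<^sub>R v) = l + 2 * t * (v \<bullet> v) + t\<^sup>2 * (T v \<bullet> v)"
      using T ve Tev sym[of v e] by (simp add: linear_add linear_cmul inner_add_left inner_add_right
          l_def power2_eq_square algebra_simps inner_commute)
    moreover have "(e + t *\<^sub>R v) \<bullet> (e + t *\<^sub>R v) = 1 + t\<^sup>2 * (v \<bullet> v)"
      using ve ee by (simp add: inner_add_left inner_add_right power2_eq_square inner_commute)
    ultimately show ?thesis
      using le[of "e + t *\<^sub>R v"] eS vS S by (simp add: subspace_add subspace_scale k_def algebra_simps)
  qed
  have "v \<bullet> v = 0"
  proof (rule ccontr)
    assume "v \<bullet> v \<noteq> 0"
    then have p: "v \<bullet> v > 0" using inner_ge_zero[of v] by linarith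
    \<comment> \<open>Small enough that \<open>?t * k\<close> is at most
      \<open>v \<bullet> v\<close>; the \<open>+ 1\<close> keeps the denominator positive.\<close>
    let ?t = "(v \<bullet> v) / (\<bar>k\<bar> + 1)"
    have t: "?t > 0" using p by simp
    have "2 * (v \<bullet> v) * ?t \<le> (?t * k) * ?t" using quad[of ?t] by (simp add: power2_eq_square algebra_simps)
    then have "2 * (v \<bullet> v) \<le> ?t * k" using t by (rule mult_right_le_imp_le)
    also have "\<dots> \<le> ?t * (\<bar>k\<bar> + 1)" using t by (intro mult_left_mono) auto
    also have "\<dots> = v \<bullet> v" by simp
    finally show False using p by simp
  qed
  then have "T e = l *\<^sub>R e" by (simp add: v_def)
  with eS en show thesis using that by blast
qed

text \<open>An orthonormal family of eigenvectors of maximal size must span: by symmetry its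
  orthogonal complement is invariant under \<open>T\<close>, and an eigenvector there would enlarge
  the family.\<close>

lemma symmetric_orthonormal_eigenbasis:
  fixes T :: "'a::euclidean_space \<Rightarrow> 'a"
  assumes T: "linear T" and sym: "\<And>x y. T x \<bullet> y = x \<bullet> T y"
  obtains B where "finite B" "pairwise orthogonal B" "\<And>e. e \<in> B \<Longrightarrow> norm e = 1"
    "\<And>e. e \<in> B \<Longrightarrow> \<exists>l. T e = l *\<^sub>R e" "span B = UNIV"
proof -
  define P where "P B \<longleftrightarrow> pairwise orthogonal B \<and> (\<forall>e\<in>B. norm e = 1 \<and> (\<exists>l. T e = l *\<^sub>R e))" for B
  have bound: "finite B \<and> card B \<le> DIM('a)" if "P B" for B
  proof -
    have "0 \<notin> B" using that by (auto simp: P_def)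
    then show ?thesis
      using that independent_bound[of B] pairwise_orthogonal_independent[of B] by (auto simp: P_def)
  qed
  have "P {}" by (simp add: P_def)
  moreover have "\<forall>B. P B \<longrightarrow> card B < Suc DIM('a)" using bound by (auto simp: less_Suc_eq_le)
  ultimately obtain B where B: "P B" and Bmax: "\<And>C. P C \<Longrightarrow> card C \<le> card B"
    using ex_has_greatest_nat[of P "{}" card "Suc DIM('a)"] by blast
  have "span B = UNIV"
  proof (rule ccontr)
    assume "span B \<noteq> UNIV"
    then have "span B \<subset> span UNIV" by auto
    then obtain x1 where x1: "x1 \<noteq> 0" "\<And>y. y \<in> span B \<Longrightarrow> orthogonal x1 y"
      using orthogonal_to_subspace_exists_gen[of B UNIV] by blast
    let ?S = "{x. \<forall>y\<in>B. y \<bullet> x = 0}"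
    have sub: "subspace ?S" by (auto simp: subspace_def inner_add_right)
    have inv: "T x \<in> ?S" if "x \<in> ?S" for x
    proof (safe)
      fix y assume y: "y \<in> B"
      then obtain l where "T y = l *\<^sub>R y" using B by (auto simp: P_def)
      then show "y \<bullet> T x = 0" using that y by (simp flip: sym)
    qed
    have x1S: "x1 \<in> ?S" using x1(2) by (auto simp: orthogonal_def span_base inner_commute)
    obtain e l where e: "e \<in> ?S" "norm e = 1" "T e = l *\<^sub>R e"
      using symmetric_eigenvector_in_invariant_subspace[OF T sym sub inv x1S x1(1)] by blast
    have "e \<notin> B" using e by (auto simp: norm_eq_1)
    moreover have "P (insert e B)"
      using B e by (auto simp: P_def pairwise_insert orthogonal_def inner_commute)
    ultimately show False using Bmax[of "insert e B"] bound[OF B] by simp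
  qed
  with B bound[OF B] that show thesis by (auto simp: P_def)
qed

lemma orthonormal_expansion:
  fixes x :: "'a::euclidean_space"
  assumes "finite B" "pairwise orthogonal B" "\<And>e. e \<in> B \<Longrightarrow> norm e = 1" "span B = UNIV"
  shows "x = (\<Sum>e\<in>B. (e \<bullet> x) *\<^sub>R e)"
  using orthonormal_basis_expand[of B x] assms by (simp add: inner_commute)

text \<open>Real form of the eigenvectors a + ib and a - ib of iA, with eigenvalues c and -c. The
  vectors may vanish and \<open>c\<close> may be 0 or negative, so kernel vectors fit in as
  well.\<close>

definition rotation_pair :: "real^'n^'n \<Rightarrow> real \<Rightarrow> real^'n \<Rightarrow> real^'n \<Rightarrow> bool" where
  "rotation_pair A c a b \<longleftrightarrow> A *v a = c *\<^sub>R b \<and> A *v b = - (c *\<^sub>R a)"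

lemma rotation_pair_swap: "rotation_pair A c a b \<Longrightarrow> rotation_pair A c b (- a)"
  using matrix_vector_mult_diff_distrib[of A 0 a]
  by (simp add: rotation_pair_def)

lemma skew_inner:
  fixes A :: "real^'n^'n"
  assumes "transpose A = - A"
  shows "(A *v x) \<bullet> y = - (x \<bullet> (A *v y))"
proof -
  have "(A *v x) \<bullet> y = x \<bullet> (transpose A *v y)"
    by (metis dot_lmul_matrix inner_commute transpose_matrix_vector)
  also have "\<dots> = - (x \<bullet> (A *v y))"
    using assms matrix_vector_mult_diff_rdistrib[of 0 A y] by simp
  finally show ?thesis .
qed

lemma skew_inner_self:
  fixes A :: "real^'n^'n"
  assumes "transpose A = - A"
  shows "x \<bullet> (A *v x) = 0"
  using skew_inner[OF assms, of x x] by (simp add: inner_commute)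

text \<open>The spectral theorem is applied to the symmetric map -A^2. The partner of a basis vector
  is its normalised image under \<open>A\<close>; it need not belong to the basis itself.\<close>

lemma skew_orthonormal_basis:
  fixes A :: "real^'n^'n"
  assumes skew: "transpose A = - A"
  obtains B c b where "finite B" "pairwise orthogonal B" "\<And>e. e \<in> B \<Longrightarrow> norm e = 1"
    "span B = UNIV" "\<And>e. e \<in> B \<Longrightarrow> rotation_pair A (c e) e (b e)"
proof -
  define T where "T x = - (A *v (A *v x))" for x
  have "linear T" by (rule linearI) (simp_all add: T_def algebra_simps)
  moreover have "T x \<bullet> y = x \<bullet> T y" for x y
    by (simp add: T_def skew_inner[OF skew])
  ultimately obtain B where B: "finite B" "pairwise orthogonal B" "\<And>e. e \<in> B \<Longrightarrow> norm e = 1"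
    "\<And>e. e \<in> B \<Longrightarrow> \<exists>l. T e = l *\<^sub>R e" "span B = UNIV"
    using symmetric_orthonormal_eigenbasis by metis
  have "\<exists>c b. rotation_pair A c e b" if eB: "e \<in> B" for e
  proof -
    obtain l where l: "T e = l *\<^sub>R e" using B(4)[OF eB] by blast
    have "e \<bullet> e = 1" using B(3)[OF eB] by (simp add: dot_square_norm)
    \<comment> \<open>Pairing the eigenvector equation with the unit vector \<open>e\<close> and
      moving one factor \<open>A\<close> across by skewness.\<close>
    then have le: "l = (norm (A *v e))\<^sup>2"
      using arg_cong[OF l, of "\<lambda>x. x \<bullet> e"]
      by (simp add: T_def skew_inner[OF skew] power2_norm_eq_inner)
    show ?thesis
    proof (cases "A *v e = 0")
      case True
      then have "rotation_pair A 0 e 0" by (simp add: rotation_pair_def)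
      then show ?thesis by blast
    next
      case False
      define c where "c = norm (A *v e)"
      have "c \<noteq> 0" "A *v (A *v e) = - (c\<^sup>2 *\<^sub>R e)"
        using False l le by (auto simp: c_def T_def minus_equation_iff[of _ "_ *\<^sub>R _"])
      then have "rotation_pair A c e ((1 / c) *\<^sub>R (A *v e))"
        by (simp add: rotation_pair_def matrix_vector_mult_scaleR power2_eq_square)
      then show ?thesis by blast
    qed
  qed
  then obtain c b where "\<And>e. e \<in> B \<Longrightarrow> rotation_pair A (c e) e (b e)" by metis
  with B that show thesis by blast
qed

lemma linear_eq_on_rotation_pairs:
  fixes A :: "real^'n^'n" and f g :: "real^'n \<Rightarrow> 'b::real_vector"
  assumes skew: "transpose A = - A" and "linear f" "linear g"
    and eq: "\<And>c a b. rotation_pair A c a b \<Longrightarrow> f a = g a"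
  shows "f x = g x"
proof -
  obtain B c b where "span B = UNIV" "\<And>e. e \<in> B \<Longrightarrow> rotation_pair A (c e) e (b e)"
    using skew_orthonormal_basis[OF skew] by metis
  then have "\<And>e. e \<in> B \<Longrightarrow> f e = g e" "x \<in> span B" using eq by blast+
  then show ?thesis
    using linear_eq_on[of f g x B] assms(2,3) by blast
qed

text \<open>Induction along the eigenbasis, for properties such as differentiability or summability
  that are closed under linear combinations but are not equations between linear maps.\<close>

lemma rotation_pair_induct [consumes 1, case_names zero add pair]:
  fixes A :: "real^'n^'n"
  assumes skew: "transpose A = - A"
    and zero: "P 0" and add: "\<And>c a b x k. rotation_pair A c a b \<Longrightarrow> P a \<Longrightarrow> P x \<Longrightarrow> P (k *\<^sub>R a + x)"
    and pair: "\<And>c a b. rotation_pair A c a b \<Longrightarrow> P a"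
  shows "P x"
proof -
  obtain B c b where B: "span B = UNIV" "\<And>e. e \<in> B \<Longrightarrow> rotation_pair A (c e) e (b e)"
    using skew_orthonormal_basis[OF skew] by metis
  then have "x \<in> span B" by simp
  then show ?thesis
    by (induction rule: span_induct_alt) (use B zero add pair in blast)+
qed

section \<open>Functional calculus and matrix exponential on rotation pairs\<close>


lemma cvec_add: "cvec (x + y) = cvec x + cvec y"
  and cvec_scaleR: "cvec (r *\<^sub>R x) = complex_of_real r *s cvec x"
  by (simp_all add: cvec_def vec_eq_iff)

lemma linear_matrix_cvec: "linear (\<lambda>x. M *v cvec x)"
  by (rule linearI)
    (simp_all add: cvec_add cvec_scaleR matrix_vector_right_distrib vector_scalar_commute,
     simp add: vec_eq_iff scaleR_conv_of_real[where 'a=complex])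

definition i_cmat :: "real^'n^'n \<Rightarrow> complex^'n^'n" where
  "i_cmat A = (\<chi> i j. \<i> * (cmat A $ i $ j))"

lemma i_cmat_cvec: "i_cmat A *v cvec x = \<i> *s cvec (A *v x)"
  by (simp add: i_cmat_def cmat_def cvec_def matrix_vector_mult_def vec_eq_iff sum_distrib_left
      mult.assoc)

text \<open>The property by which \<open>mat_fun\<close> selects its matrix; existence and
  uniqueness have to be proved before the description operator says anything.\<close>

definition acts_on_eigenvectors :: "(complex \<Rightarrow> complex) \<Rightarrow> complex^'n^'n \<Rightarrow> complex^'n^'n \<Rightarrow> bool" where
  "acts_on_eigenvectors f H M \<longleftrightarrow> (\<forall>v d. H *v v = d *s v \<longrightarrow> M *v v = f d *s v)"

lemma i_cmat_eigenvector:
  fixes A :: "real^'n^'n" and s :: complex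
  assumes pair: "rotation_pair A c a b" and s: "s * s = 1"
  shows "i_cmat A *v (cvec a + (s * \<i>) *s cvec b) = (s * c) *s (cvec a + (s * \<i>) *s cvec b)"
proof -
  have Aa: "A *v a = c *\<^sub>R b" and Ab: "A *v b = (- c) *\<^sub>R a"
    using pair by (simp_all add: rotation_pair_def)
  have "i_cmat A *v (cvec a + (s * \<i>) *s cvec b)
      = \<i> *s (of_real c *s cvec b) + (s * \<i>) *s (\<i> *s (of_real (- c) *s cvec a))"
    by (simp only: matrix_vector_right_distrib vector_scalar_commute i_cmat_cvec Aa Ab cvec_scaleR)
  also have "\<dots> = (s * c) *s (cvec a + (s * \<i>) *s cvec b)"
    using s by (simp add: vec_eq_iff algebra_simps)
  finally show ?thesis .
qed

text \<open>\<open>cvec a\<close> is half the sum of the eigenvectors for c and -c, and an even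
  \<open>f\<close> takes the same value at both.\<close>

lemma acts_on_rotation_pair:
  fixes A :: "real^'n^'n"
  assumes even: "\<And>z. f (- z) = f z" and M: "acts_on_eigenvectors f (i_cmat A) M"
    and pair: "rotation_pair A c a b"
  shows "M *v cvec a = f (complex_of_real c) *s cvec a"
proof -
  let ?p = "cvec a + (1 * \<i>) *s cvec b" and ?m = "cvec a + ((-1) * \<i>) *s cvec b"
  have "M *v ?p = f c *s ?p"
    using M i_cmat_eigenvector[OF pair, of 1] unfolding acts_on_eigenvectors_def by fastforce
  moreover have "M *v ?m = f c *s ?m"
    using M i_cmat_eigenvector[OF pair, of "-1"] even unfolding acts_on_eigenvectors_def by fastforce
  ultimately have "M *v (?p + ?m) = f c *s (?p + ?m)"
    by (simp only: matrix_vector_right_distrib vector_add_ldistrib)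
  moreover have "?p + ?m = 2 *s cvec a" by (simp add: vec_eq_iff)
  ultimately have "2 *s (M *v cvec a) = 2 *s (f c *s cvec a)"
    by (simp add: vector_scalar_commute mult.commute)
  then show ?thesis by (simp add: vec_eq_iff)
qed

text \<open>Existence: the sum of the projections onto the real eigenbasis weighted by f(c) works,
  because an eigenvector with eigenvalue d only has components with c^2 = d^2. Uniqueness: the
  values on rotation pairs are forced.\<close>

lemma mat_fun_acts_on_eigenvectors:
  fixes A :: "real^'n^'n"
  assumes skew: "transpose A = - A" and even: "\<And>z. f (- z) = f z"
  shows "acts_on_eigenvectors f (i_cmat A) (mat_fun f (i_cmat A))"
proof -
  obtain B c b where B: "finite B" "pairwise orthogonal B" "\<And>e. e \<in> B \<Longrightarrow> norm e = 1"
    "span B = UNIV" and pair: "\<And>e. e \<in> B \<Longrightarrow> rotation_pair A (c e) e (b e)"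
    using skew_orthonormal_basis[OF skew] by metis
  let ?H = "i_cmat A"
  \<comment> \<open>The bilinear coefficient of a complex vector along a real one; the expansion
    over \<open>B\<close> holds for it because \<open>B\<close> is a real orthonormal basis.\<close>
  define p where "p e v = (\<Sum>k\<in>UNIV. complex_of_real (e $ k) * v $ k)" for e :: "real^'n" and v :: "complex^'n"
  define M :: "complex^'n^'n" where "M = (\<chi> j k. \<Sum>e\<in>B. f (c e) * (e $ j) * (e $ k))"
  have delta: "(\<Sum>e\<in>B. e $ j * e $ k) = (if j = k then 1 else 0)" for j k
  proof -
    have "axis k 1 $ j = (\<Sum>e\<in>B. (e \<bullet> axis k 1) *\<^sub>R e) $ j"
      using orthonormal_expansion[OF B] by metis
    then show ?thesis by (simp add: inner_axis mult.commute) (simp add: axis_def split: if_splits)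
  qed
  have expand: "v $ j = (\<Sum>e\<in>B. p e v * e $ j)" for v j
  proof -
    have "(\<Sum>e\<in>B. p e v * e $ j) = (\<Sum>k\<in>UNIV. \<Sum>e\<in>B. complex_of_real (e $ k) * v $ k * e $ j)"
      unfolding p_def sum_distrib_right by (rule sum.swap)
    also have "\<dots> = (\<Sum>k\<in>UNIV. complex_of_real (\<Sum>e\<in>B. e $ j * e $ k) * v $ k)"
      by (simp add: sum_distrib_left sum_distrib_right mult_ac)
    also have "\<dots> = (\<Sum>k\<in>UNIV. if j = k then v $ k else 0)"
      by (intro sum.cong refl) (simp add: delta)
    finally show ?thesis by simp
  qed
  have A_swap: "A $ k $ l = - A $ l $ k" for k l
    using arg_cong[OF skew, of "\<lambda>X. X $ l $ k"] by (simp add: transpose_def)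
  \<comment> \<open>Skewness transfers the matrix from \<open>v\<close> to the real vector
    \<open>e\<close>, at the cost of a sign.\<close>
  have pH: "p e (?H *v v) = - \<i> * p (A *v e) v" for e v
  proof -
    have "p e (?H *v v) = (\<Sum>l\<in>UNIV. \<Sum>k\<in>UNIV. complex_of_real (e $ k) * (\<i> * A $ k $ l * v $ l))"
      unfolding p_def matrix_vector_mult_def i_cmat_def cmat_def
      by (simp add: sum_distrib_left) (rule sum.swap)
    also have "\<dots> = (\<Sum>l\<in>UNIV. \<Sum>k\<in>UNIV. - \<i> * (A $ l $ k * complex_of_real (e $ k) * v $ l))"
      by (intro sum.cong refl, subst A_swap) simp
    also have "\<dots> = - \<i> * p (A *v e) v"
      by (simp add: p_def matrix_vector_mult_def sum_distrib_left sum_distrib_right)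
    finally show ?thesis .
  qed
  have Mv: "(M *v v) $ j = (\<Sum>e\<in>B. f (c e) * p e v * e $ j)" for v j
  proof -
    have "(M *v v) $ j = (\<Sum>k\<in>UNIV. \<Sum>e\<in>B. f (c e) * (e $ j) * (e $ k) * v $ k)"
      by (simp add: M_def matrix_vector_mult_def sum_distrib_right)
    also have "\<dots> = (\<Sum>e\<in>B. \<Sum>k\<in>UNIV. f (c e) * (e $ j) * (e $ k) * v $ k)"
      by (rule sum.swap)
    finally show ?thesis by (simp add: p_def sum_distrib_left sum_distrib_right mult_ac)
  qed
  have M: "acts_on_eigenvectors f ?H M"
    unfolding acts_on_eigenvectors_def
  proof (intro allI impI)
    fix v d assume v: "?H *v v = d *s v"
    have "f (c e) * p e v = f d * p e v" if e: "e \<in> B" for e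
    proof (cases "p e v = 0")
      case False
      have lin: "p e (d *s v) = d * p e v" for v
        by (simp add: p_def sum_distrib_left mult_ac)
      \<comment> \<open>Applying the matrix twice makes it act on \<open>e\<close> through the
        square of \<open>A\<close>, for which \<open>e\<close> is an eigenvector.\<close>
      have "d * (d * p e v) = p e (?H *v (?H *v v))" by (simp only: v lin vector_scalar_commute)
      also have "\<dots> = - p (A *v (A *v e)) v" by (simp add: pH)
      also have "A *v (A *v e) = - ((c e)\<^sup>2 *\<^sub>R e)"
        using pair[OF e] by (simp add: rotation_pair_def matrix_vector_mult_scaleR power2_eq_square)
      also have "- p (- ((c e)\<^sup>2 *\<^sub>R e)) v = (complex_of_real (c e))\<^sup>2 * p e v"
        by (simp add: p_def sum_negf sum_distrib_left mult_ac)
      finally have "d\<^sup>2 = (complex_of_real (c e))\<^sup>2" using False by (simp add: power2_eq_square)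
      then have "d = c e \<or> d = - complex_of_real (c e)" by (simp add: power2_eq_iff)
      then show ?thesis using even by auto
    qed simp
    then have "(M *v v) $ j = (\<Sum>e\<in>B. f d * p e v * e $ j)" for j
      unfolding Mv by (intro sum.cong) auto
    then have "(M *v v) $ j = (f d *s v) $ j" for j
      by (simp add: expand[of v j] sum_distrib_left mult.assoc)
    then show "M *v v = f d *s v" by (simp add: vec_eq_iff)
  qed
  have "M' = M" if M': "acts_on_eigenvectors f ?H M'" for M'
  proof -
    have eq: "M' *v cvec x = M *v cvec x" for x
    proof (rule linear_eq_on_rotation_pairs[OF skew linear_matrix_cvec linear_matrix_cvec])
      fix c a b assume "rotation_pair A c a b"
      then show "M' *v cvec a = M *v cvec a"
        by (simp only: acts_on_rotation_pair[of f A M', OF even M'] acts_on_rotation_pair[of f A M, OF even M])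
    qed
    \<comment> \<open>Standard basis vectors are real, so agreement on real vectors fixes every
      column of the complex matrix.\<close>
    have "cvec (axis k 1) = axis k 1" for k :: 'n by (simp add: cvec_def axis_def vec_eq_iff)
    moreover have "(C *v axis k 1) $ i = C $ i $ k" for C :: "complex^'n^'n" and i k
      by (simp add: matrix_vector_mult_def axis_def if_distrib cong: if_cong)
    ultimately have "M' $ i $ k = M $ i $ k" for i k
      using eq[of "axis k 1"] by metis
    then show ?thesis by (simp add: vec_eq_iff)
  qed
  then have "mat_fun f ?H = M"
    unfolding mat_fun_def acts_on_eigenvectors_def[symmetric] using M by (rule the_equality[rotated])
  with M show ?thesis by simp
qed

lemma Uc_eq: "Uc Us \<theta> = i_cmat (Ut Us \<theta>)"
  by (simp add: Uc_def i_cmat_def)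

lemma linear_Uapply: "linear (Uapply Us f \<theta>)"
proof -
  have "linear rvec" by (rule linearI) (simp_all add: rvec_def vec_eq_iff)
  then show ?thesis
    using linear_compose[OF linear_matrix_cvec, of rvec "mat_fun f (Uc Us \<theta>)"]
    by (simp add: Uapply_def[abs_def] o_def)
qed

lemma Uapply_rotation_pair:
  assumes "transpose (Ut Us \<theta>) = - Ut Us \<theta>" "\<And>z. f (- z) = f z" "rotation_pair (Ut Us \<theta>) c a b"
  shows "Uapply Us f \<theta> a = Re (f (complex_of_real c)) *\<^sub>R a"
proof -
  have "mat_fun f (Uc Us \<theta>) *v cvec a = f (complex_of_real c) *s cvec a"
    unfolding Uc_eq
    by (rule acts_on_rotation_pair[of f, OF assms(2) mat_fun_acts_on_eigenvectors[of _ f, OF assms(1,2)] assms(3)])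
  then show ?thesis
    by (simp add: Uapply_def rvec_def cvec_def vec_eq_iff)
qed

text \<open>Pointwise convergence defines a linear limit map; testing on the standard basis gives
  entrywise convergence of the matrices to its matrix.\<close>

lemma matrix_sums_mult_vec:
  fixes M :: "nat \<Rightarrow> real^'n^'m"
  assumes "\<And>x. summable (\<lambda>k. M k *v x)"
  shows "suminf M *v x = (\<Sum>k. M k *v x)"
proof -
  have lin: "linear (\<lambda>x. \<Sum>k. M k *v x)"
    by (rule linearI)
      (simp_all add: matrix_vector_right_distrib matrix_vector_mult_scaleR suminf_add[OF assms assms]
        suminf_scaleR_right[OF assms])
  define L where "L = matrix (\<lambda>x. \<Sum>k. M k *v x)"
  have L: "L *v x = (\<Sum>k. M k *v x)" for x unfolding L_def by (rule matrix_works) (use lin in \<open>simp add: linear_def scalar_mult_eq_scaleR[abs_def]\<close>)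
  have "(\<lambda>n. (\<Sum>k<n. M k) $ i $ j) \<longlonglongrightarrow> L $ i $ j" for i j
  proof -
    have "(\<lambda>n. \<Sum>k<n. M k *v axis j 1) \<longlonglongrightarrow> L *v axis j 1"
      unfolding L using assms by (simp add: summable_LIMSEQ)
    then have "(\<lambda>n. (\<Sum>k<n. M k *v axis j 1) $ i) \<longlonglongrightarrow> (L *v axis j 1) $ i"
      by (rule tendsto_vec_nth)
    then show ?thesis by (simp add: matrix_vector_mult_basis column_def)
  qed
  then have "(\<lambda>n. \<Sum>k<n. M k) \<longlonglongrightarrow> L"
    by (intro vec_tendstoI)
  then have "M sums L" by (simp add: sums_def)
  then show ?thesis using L by (simp add: sums_iff)
qed

text \<open>On the span of a pair \<open>A\<close> acts as c times a quarter turn, so the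
  exponential series splits into the cosine series along \<open>a\<close> and the sine series along
  \<open>b\<close>.\<close>

lemma mexp_rotation_pair:
  fixes A :: "real^'n^'n"
  assumes skew: "transpose A = - A" and pair: "rotation_pair A c a b"
  shows "mexp (s *\<^sub>R A) *v a = cos (s * c) *\<^sub>R a + sin (s * c) *\<^sub>R b"
proof -
  let ?M = "\<lambda>k. (1 / fact k) *\<^sub>R ((((**) (s *\<^sub>R A)) ^^ k) (mat 1))"
  have step: "?M (Suc k) *v x = (s / real (Suc k)) *\<^sub>R (A *v (?M k *v x))" for k x
    by (simp add: matrix_vector_mul_assoc[symmetric] scaleR_matrix_vector_assoc[symmetric]
        matrix_vector_mult_scaleR)
  have M_eq: "?M k *v a = (cos_coeff k *\<^sub>R (s * c) ^ k) *\<^sub>R a + (sin_coeff k *\<^sub>R (s * c) ^ k) *\<^sub>R b"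
    if "rotation_pair A c a b" for k c a b
  proof (induction k)
    case 0
    show ?case by simp
  next
    case (Suc k)
    show ?case
      unfolding step Suc cos_coeff_Suc sin_coeff_Suc
      using that
      by (simp add: rotation_pair_def matrix_vector_right_distrib matrix_vector_mult_scaleR
          matrix_vector_mult_diff_distrib scaleR_add_right scaleR_diff_right mult_ac del: of_nat_Suc)
  qed
  have S: "(\<lambda>k. ?M k *v a) sums (cos (s * c) *\<^sub>R a + sin (s * c) *\<^sub>R b)"
    if "rotation_pair A c a b" for c a b
    unfolding M_eq[OF that]
    by (intro sums_add sums_scaleR_left cos_converges sin_converges)
  \<comment> \<open>Convergence on every vector, not only on \<open>a\<close>, is what gives a
    meaning to the matrix series inside \<open>mexp\<close>.\<close>
  have "summable (\<lambda>k. ?M k *v x)" for x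
    using skew
  proof (induction x rule: rotation_pair_induct)
    case zero
    show ?case by simp
  next
    case (add c a b x k)
    then show ?case
      by (simp only: matrix_vector_right_distrib matrix_vector_mult_scaleR)
        (intro summable_add summable_scaleR_right)
  next
    case (pair c a b)
    then show ?case using S by (blast intro: sums_summable)
  qed
  then show ?thesis
    unfolding mexp_def using S[OF pair] by (simp only: matrix_sums_mult_vec sums_iff)
qed

section \<open>The curve and its velocity\<close>


text \<open>No nonzero eigenvalue of iA is a multiple of pi. The condition on \<open>a\<close>
  excludes the zero vector, which can be paired with any \<open>c\<close>.\<close>

definition nonresonant :: "real^'n^'n \<Rightarrow> bool" where
  "nonresonant A \<longleftrightarrow> (\<forall>c a b. rotation_pair A c a b \<longrightarrow> a \<noteq> 0 \<longrightarrow> c \<noteq> 0 \<longrightarrow> sin c \<noteq> 0)"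

text \<open>If \<open>a\<close> is 0 and \<open>c\<close> is not, the pair equations force
  \<open>b\<close> to be 0 too.\<close>

lemma nonresonant_cases:
  assumes "nonresonant A" "rotation_pair A c a b"
  obtains "c = 0" | "a = 0" "b = 0" | "c \<noteq> 0" "sin c \<noteq> 0"
  using assms unfolding nonresonant_def rotation_pair_def
  by (metis matrix_vector_mult_0_right scaleR_eq_0_iff)

section \<open>The scalar functions at real arguments, and the curves for arbitrary
  parameters\<close>

lemma sin_ratio_of_real:
  "sin_ratio s (complex_of_real c) = complex_of_real (if c = 0 then s else sin (s * c) / sin c)"
  unfolding sin_ratio_def by (simp flip: sin_of_real of_real_mult)

lemma z_over_sin_of_real:
  "z_over_sin (complex_of_real c) = complex_of_real (if c = 0 then 1 else c / sin c)"
  unfolding z_over_sin_def by (simp flip: sin_of_real)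

lemma z_cot_of_real:
  "z_cot (complex_of_real c) = complex_of_real (if c = 0 then 1 else c * cos c / sin c)"
  unfolding z_cot_def by (simp flip: sin_of_real cos_of_real)

text \<open>The curve x(s) of the theorem with parameter and end point as arguments, so that curves
  of nearby parameters can be compared; \<open>geo_velocity\<close> does the same for
  \<open>\<zeta>\<close>.\<close>

definition geo_point :: "('m::finite \<Rightarrow> real^'q^'q) \<Rightarrow> real^'m \<Rightarrow> real^'q \<Rightarrow> real \<Rightarrow> real^'q" where
  "geo_point Us \<theta> x s = Uapply Us (sin_ratio s) \<theta> (mexp ((s - 1) *\<^sub>R Ut Us \<theta>) *v x)"

definition geo_velocity :: "('m::finite \<Rightarrow> real^'q^'q) \<Rightarrow> real^'m \<Rightarrow> real^'q \<Rightarrow> real \<Rightarrow> real^'q" where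
  "geo_velocity Us \<theta> x s = Uapply Us z_over_sin \<theta> (mexp ((2 * s - 1) *\<^sub>R Ut Us \<theta>) *v x)"

lemma linear_Uapply_mult: "linear (\<lambda>x. Uapply Us f \<theta> (M *v x))"
  using linear_compose[OF matrix_vector_mul_linear[of M] linear_Uapply[of Us f \<theta>]]
  by (simp add: o_def)

lemma linear_geo_point: "linear (\<lambda>x. geo_point Us \<theta> x s)"
  unfolding geo_point_def by (rule linear_Uapply_mult)

lemma linear_geo_velocity: "linear (\<lambda>x. geo_velocity Us \<theta> x s)"
  unfolding geo_velocity_def by (rule linear_Uapply_mult)

lemma has_vector_derivative_comb:
  fixes a b :: "'a::real_normed_vector"
  assumes "(f has_real_derivative f') (at s within S)" "(g has_real_derivative g') (at s within S)"
  shows "((\<lambda>s. f s *\<^sub>R a + g s *\<^sub>R b) has_vector_derivative f' *\<^sub>R a + g' *\<^sub>R b) (at s within S)"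
  using has_vector_derivative_add[OF has_vector_derivative_scaleR[OF assms(1) has_vector_derivative_const[of a]]
    has_vector_derivative_scaleR[OF assms(2) has_vector_derivative_const[of b]]] by simp

lemma mexp_zero_mult:
  fixes A :: "real^'n^'n"
  assumes skew: "transpose A = - A"
  shows "mexp (0 *\<^sub>R A) *v x = x"
  by (rule linear_eq_on_rotation_pairs[OF skew])
    (simp_all only: mexp_rotation_pair[OF skew], simp_all add: linear_ident)

context
  fixes Us :: "'m::finite \<Rightarrow> real^'q::finite^'q" and \<theta> :: "real^'m" and A :: "real^'q^'q"
  defines "A \<equiv> Ut Us \<theta>"
  assumes skewA: "transpose A = - A"
begin

text \<open>By \<open>rotation_pair_swap\<close> the partner \<open>b\<close> is multiplied by the
  same scalar as \<open>a\<close>.\<close>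

lemma Uapply_comb:
  assumes even: "\<And>z. f (- z) = f z" and pair: "rotation_pair A c a b"
  shows "Uapply Us f \<theta> (\<alpha> *\<^sub>R a + \<beta> *\<^sub>R b) = Re (f (complex_of_real c)) *\<^sub>R (\<alpha> *\<^sub>R a + \<beta> *\<^sub>R b)"
  using Uapply_rotation_pair[of Us \<theta> f, OF skewA[unfolded A_def] even pair[unfolded A_def]]
    Uapply_rotation_pair[of Us \<theta> f, OF skewA[unfolded A_def] even rotation_pair_swap[OF pair[unfolded A_def]]]
  by (simp add: linear_add[OF linear_Uapply] linear_cmul[OF linear_Uapply] scaleR_add_right mult.commute)

lemma geo_point_pair:
  assumes pair: "rotation_pair A c a b"
  shows "geo_point Us \<theta> a s = (if c = 0 then s else sin (s * c) / sin c) *\<^sub>R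
           (cos ((s - 1) * c) *\<^sub>R a + sin ((s - 1) * c) *\<^sub>R b)"
proof -
  have even: "sin_ratio s (- z) = sin_ratio s z" for z by (simp add: sin_ratio_def)
  show ?thesis
    unfolding geo_point_def A_def[symmetric] mexp_rotation_pair[OF skewA pair]
    by (simp only: Uapply_comb[of "sin_ratio s", OF even pair] sin_ratio_of_real Re_complex_of_real)
qed

lemma z_over_sin_comb:
  assumes pair: "rotation_pair A c a b"
  shows "Uapply Us z_over_sin \<theta> (\<alpha> *\<^sub>R a + \<beta> *\<^sub>R b)
     = (if c = 0 then 1 else c / sin c) *\<^sub>R (\<alpha> *\<^sub>R a + \<beta> *\<^sub>R b)"
proof -
  have even: "z_over_sin (- z) = z_over_sin z" for z by (simp add: z_over_sin_def)
  show ?thesis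
    by (simp only: Uapply_comb[of z_over_sin, OF even pair] z_over_sin_of_real Re_complex_of_real)
qed

lemma geo_velocity_pair:
  assumes pair: "rotation_pair A c a b"
  shows "geo_velocity Us \<theta> a s = (if c = 0 then 1 else c / sin c) *\<^sub>R
           (cos ((2 * s - 1) * c) *\<^sub>R a + sin ((2 * s - 1) * c) *\<^sub>R b)"
  unfolding geo_velocity_def A_def[symmetric] mexp_rotation_pair[OF skewA pair]
  by (rule z_over_sin_comb[OF pair])

lemma z_cot_pair:
  assumes pair: "rotation_pair A c a b"
  shows "Uapply Us z_cot \<theta> a = (if c = 0 then 1 else c * cos c / sin c) *\<^sub>R a"
proof -
  have even: "z_cot (- z) = z_cot z" for z by (simp add: z_cot_def)
  show ?thesis
    using Uapply_comb[of z_cot, OF even pair, of 1 0] by (simp add: z_cot_of_real)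
qed

lemma geo_velocity_derivative:
  "(geo_velocity Us \<theta> x has_vector_derivative 2 *\<^sub>R (A *v geo_velocity Us \<theta> x s)) (at s)"
  using skewA
proof (induction x rule: rotation_pair_induct)
  case zero
  have "geo_velocity Us \<theta> 0 = (\<lambda>s. 0)" using linear_0[OF linear_geo_velocity] by blast
  then show ?case by simp
next
  case (add c a b x k)
  have "geo_velocity Us \<theta> (k *\<^sub>R a + x) = (\<lambda>s. k *\<^sub>R geo_velocity Us \<theta> a s + geo_velocity Us \<theta> x s)"
    by (simp add: fun_eq_iff linear_add[OF linear_geo_velocity] linear_cmul[OF linear_geo_velocity])
  then show ?case using add
    by (auto intro!: derivative_eq_intros simp: algebra_simps)
next
  case (pair c a b)
  define r where "r = (if c = 0 then 1 else c / sin c)"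
  have V: "geo_velocity Us \<theta> a = (\<lambda>s. r *\<^sub>R (cos ((2 * s - 1) * c) *\<^sub>R a + sin ((2 * s - 1) * c) *\<^sub>R b))"
    unfolding r_def using geo_velocity_pair[OF pair] by blast
  have "((\<lambda>s. cos ((2 * s - 1) * c) *\<^sub>R a + sin ((2 * s - 1) * c) *\<^sub>R b) has_vector_derivative
      2 *\<^sub>R (A *v (cos ((2 * s - 1) * c) *\<^sub>R a + sin ((2 * s - 1) * c) *\<^sub>R b))) (at s)"
    using pair
    by (auto intro!: derivative_eq_intros simp: rotation_pair_def algebra_simps)
  from bounded_linear.has_vector_derivative[OF bounded_linear_scaleR_right[of r] this]
  show ?case unfolding V by (simp only: matrix_vector_mult_scaleR scaleR_left_commute[of 2 r])
qed

lemma geo_velocity_half: "geo_velocity Us \<theta> x (1/2) = Uapply Us z_over_sin \<theta> x"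
  unfolding geo_velocity_def using mexp_zero_mult[OF skewA, of x] by (simp add: A_def)

context
  assumes nonres: "nonresonant A"
begin

lemma geo_point_derivative:
  "(geo_point Us \<theta> x has_vector_derivative geo_velocity Us \<theta> x s) (at s)"
  using skewA
proof (induction x rule: rotation_pair_induct)
  case zero
  have "geo_point Us \<theta> 0 = (\<lambda>s. 0)" "geo_velocity Us \<theta> 0 s = 0"
    using linear_0[OF linear_geo_velocity] linear_0[OF linear_geo_point] by blast+
  then show ?case by simp
next
  case (add c a b x k)
  have "geo_point Us \<theta> (k *\<^sub>R a + x) = (\<lambda>s. k *\<^sub>R geo_point Us \<theta> a s + geo_point Us \<theta> x s)"
    "geo_velocity Us \<theta> (k *\<^sub>R a + x) s = k *\<^sub>R geo_velocity Us \<theta> a s + geo_velocity Us \<theta> x s"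
    by (simp_all add: fun_eq_iff linear_add[OF linear_geo_velocity] linear_cmul[OF linear_geo_velocity]
        linear_add[OF linear_geo_point] linear_cmul[OF linear_geo_point])
  then show ?case using add
    by (auto intro!: derivative_eq_intros)
next
  case (pair c a b)
  have X: "geo_point Us \<theta> a = (\<lambda>s. (if c = 0 then s else sin (s * c) / sin c) *\<^sub>R
           (cos ((s - 1) * c) *\<^sub>R a + sin ((s - 1) * c) *\<^sub>R b))"
    using geo_point_pair[OF pair] by blast
  from nonres pair show ?case
  proof (cases rule: nonresonant_cases)
    case 1
    then show ?thesis unfolding X geo_velocity_pair[OF pair] by (auto intro!: derivative_eq_intros)
  next
    case 2
    then show ?thesis unfolding X geo_velocity_pair[OF pair] by simp
  next
    case 3
    \<comment> \<open>This splitting turns the derivatives of the products into the addition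
      formulas for cosine and sine.\<close>
    have e: "(2 * s - 1) * c = s * c + (s - 1) * c" by (simp add: algebra_simps)
    have "((\<lambda>s. sin (s * c) * cos ((s - 1) * c)) has_real_derivative c * cos ((2 * s - 1) * c)) (at s)"
      unfolding e cos_add by (auto intro!: derivative_eq_intros simp: algebra_simps)
    moreover have "((\<lambda>s. sin (s * c) * sin ((s - 1) * c)) has_real_derivative c * sin ((2 * s - 1) * c)) (at s)"
      unfolding e sin_add by (auto intro!: derivative_eq_intros simp: algebra_simps)
    ultimately have "((\<lambda>s. (sin (s * c) * cos ((s - 1) * c) / sin c) *\<^sub>R a + (sin (s * c) * sin ((s - 1) * c) / sin c) *\<^sub>R b)
      has_vector_derivative (c * cos ((2 * s - 1) * c) / sin c) *\<^sub>R a + (c * sin ((2 * s - 1) * c) / sin c) *\<^sub>R b) (at s)"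
      by (intro has_vector_derivative_comb DERIV_cdivide)
    then show ?thesis unfolding X geo_velocity_pair[OF pair] using 3 by (simp add: scaleR_add_right)
  qed
qed

lemma geo_point_0: "geo_point Us \<theta> x 0 = 0"
  by (rule linear_eq_on_rotation_pairs[OF skewA linear_geo_point, of "\<lambda>x. 0"])
    (simp_all add: geo_point_pair linear_zero)

lemma geo_point_1: "geo_point Us \<theta> x 1 = x"
proof (rule linear_eq_on_rotation_pairs[OF skewA linear_geo_point, of "\<lambda>x. x"])
  fix c a b assume pair: "rotation_pair A c a b"
  from nonres pair show "geo_point Us \<theta> a 1 = a"
    by (cases rule: nonresonant_cases) (simp_all add: linear_0[OF linear_geo_point] geo_point_pair[OF pair])
qed (simp add: linear_ident)

text \<open>This is how z cot z enters: at s = 1 the velocity is c / sin c times the rotation of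
  \<open>a\<close> by the angle c.\<close>

lemma geo_velocity_1: "geo_velocity Us \<theta> x 1 = Uapply Us z_cot \<theta> x + A *v x"
proof (rule linear_eq_on_rotation_pairs[OF skewA linear_geo_velocity])
  show "linear (\<lambda>x. Uapply Us z_cot \<theta> x + A *v x)"
    by (intro linear_compose_add linear_Uapply) simp
  fix c a b assume pair: "rotation_pair A c a b"
  then have "A *v a = c *\<^sub>R b" by (simp add: rotation_pair_def)
  with nonres pair show "geo_velocity Us \<theta> a 1 = Uapply Us z_cot \<theta> a + A *v a"
    by (cases rule: nonresonant_cases)
      (simp_all add: linear_0[OF linear_geo_velocity] linear_0[OF linear_Uapply] geo_velocity_pair[OF pair] z_cot_pair[OF pair] scaleR_add_right)
qed

text \<open>Quantitative injectivity of the integrated flow. On a pair it is rotation by c scaled by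
  sin c / c, hence it has an explicit linear left inverse, and \<open>K\<close> bounds that
  inverse.\<close>

lemma flow_integral_coercive:
  obtains K where "K > 0" "\<And>x. norm x \<le> K * norm (integral {0..1} (\<lambda>s. mexp ((2 * s) *\<^sub>R A) *v x))"
proof -
  define N where "N x = integral {0..1} (\<lambda>s. mexp ((2 * s) *\<^sub>R A) *v x)" for x
  \<comment> \<open>Antiderivative of the rotation by 2sc that vanishes at s = 0, by the double
    angle formulas.\<close>
  define P where "P c a b s = (if c = 0 then s *\<^sub>R a else (sin (s * c) / c) *\<^sub>R (cos (s * c) *\<^sub>R a + sin (s * c) *\<^sub>R b))"
    for c s :: real and a b :: "real^'q"
  have P: "((\<lambda>s. mexp ((2 * s) *\<^sub>R A) *v a) has_integral P c a b 1 - P c a b 0) {0..1}"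
    if pair: "rotation_pair A c a b" for c a b
  proof (rule fundamental_theorem_of_calculus)
    fix s :: real
    show "(P c a b has_vector_derivative mexp ((2 * s) *\<^sub>R A) *v a) (at s within {0..1})"
    proof (cases "c = 0")
      case True
      have "P c a b = (\<lambda>s. s *\<^sub>R a)" using True by (auto simp: P_def)
      then show ?thesis using True unfolding mexp_rotation_pair[OF skewA pair]
        by (auto intro!: derivative_eq_intros)
    next
      case False
      have e: "2 * s * c = s * c + s * c" by simp
      have "((\<lambda>s. sin (s * c) * cos (s * c) / c) has_real_derivative cos (2 * s * c)) (at s within {0..1})"
        unfolding e cos_add using False
        by (auto intro!: derivative_eq_intros simp: field_simps)
      moreover have "((\<lambda>s. sin (s * c) * sin (s * c) / c) has_real_derivative sin (2 * s * c)) (at s within {0..1})"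
        unfolding e sin_add using False
        by (auto intro!: derivative_eq_intros simp: field_simps)
      ultimately have "((\<lambda>s. (sin (s * c) * cos (s * c) / c) *\<^sub>R a + (sin (s * c) * sin (s * c) / c) *\<^sub>R b)
        has_vector_derivative cos (2 * s * c) *\<^sub>R a + sin (2 * s * c) *\<^sub>R b) (at s within {0..1})"
        by (rule has_vector_derivative_comb)
      moreover have "P c a b = (\<lambda>s. (sin (s * c) * cos (s * c) / c) *\<^sub>R a + (sin (s * c) * sin (s * c) / c) *\<^sub>R b)"
        using False by (auto simp: P_def scaleR_add_right)
      ultimately show ?thesis unfolding mexp_rotation_pair[OF skewA pair] by simp
    qed
  qed simp
  have int: "(\<lambda>s. mexp ((2 * s) *\<^sub>R A) *v x) integrable_on {0..1}" for x
    using skewA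
  proof (induction x rule: rotation_pair_induct)
    case zero
    show ?case by (simp add: integrable_0)
  next
    case (add c a b x k)
    then show ?case
      by (simp only: matrix_vector_right_distrib matrix_vector_mult_scaleR)
        (intro integrable_add integrable_cmul)
  next
    case (pair c a b)
    then show ?case using P by blast
  qed
  have linN: "linear N"
    unfolding N_def
    by (rule linearI)
      (simp_all only: matrix_vector_right_distrib matrix_vector_mult_scaleR
        Henstock_Kurzweil_Integration.integral_add[OF int int] integral_cmul)
  \<comment> \<open>The left inverse: undo the rotation with exp(-A), then the factor sin c / c with
    z / sin z.\<close>
  define L where "L y = Uapply Us z_over_sin \<theta> (mexp ((-1) *\<^sub>R A) *v y)" for y
  have linL: "linear L" unfolding L_def by (rule linear_Uapply_mult)
  have LN: "L (N x) = x" for x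
  proof (rule linear_eq_on_rotation_pairs[OF skewA, of "\<lambda>x. L (N x)" "\<lambda>x. x"])
    show "linear (\<lambda>x. L (N x))" using linear_compose[OF linN linL] by (simp add: o_def)
    fix c a b assume pair: "rotation_pair A c a b"
    have N: "N a = P c a b 1" unfolding N_def using P[OF pair] by (simp add: integral_unique P_def)
    define r where "r = (if c = 0 then 1 else c / sin c)"
    have La: "L a = (if c = 0 then 1 else c / sin c) *\<^sub>R (cos c *\<^sub>R a + (- sin c) *\<^sub>R b)"
      unfolding L_def using mexp_rotation_pair[OF skewA pair, of "-1"] z_over_sin_comb[OF pair, of "cos c" "- sin c"]
      by simp
    have Lb: "L b = (if c = 0 then 1 else c / sin c) *\<^sub>R (sin c *\<^sub>R a + cos c *\<^sub>R b)"
      unfolding L_def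
      using mexp_rotation_pair[OF skewA rotation_pair_swap[OF pair], of "-1"] z_over_sin_comb[OF pair, of "sin c" "cos c"]
      by (simp add: add.commute)
    from nonres pair show "L (N a) = a"
    proof (cases rule: nonresonant_cases)
      case 1
      then show ?thesis by (simp add: N P_def La)
    next
      case 2
      then show ?thesis by (simp add: linear_0[OF linL] linear_0[OF linN])
    next
      case 3
      have comb: "k *\<^sub>R (x *\<^sub>R r *\<^sub>R (x *\<^sub>R a + (- y) *\<^sub>R b) + y *\<^sub>R r *\<^sub>R (y *\<^sub>R a + x *\<^sub>R b))
          = (k * r * (x * x + y * y)) *\<^sub>R a" for k r x y
        by (simp add: vec_eq_iff algebra_simps)
      have "L (N a) = (sin c / c) *\<^sub>R (cos c *\<^sub>R L a + sin c *\<^sub>R L b)"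
        using 3 by (simp add: N P_def linear_add[OF linL] linear_cmul[OF linL])
      also have "\<dots> = ((sin c / c) * r * (cos c * cos c + sin c * sin c)) *\<^sub>R a"
        unfolding La Lb r_def[symmetric] by (rule comb)
      also have "\<dots> = (cos c * cos c + sin c * sin c) *\<^sub>R a"
        using 3 by (simp add: r_def)
      also have "\<dots> = a" using sin_cos_squared_add3[of c] by (simp add: add.commute)
      finally show ?thesis .
    qed
  qed (simp_all add: linear_ident)
  obtain K where K: "K > 0" "\<And>y. norm (L y) \<le> K * norm y"
    using linear_bounded_pos[OF linL] by blast
  then show thesis using that[of K] LN unfolding N_def by metis
qed

end
end

section \<open>Perturbation of skew flows\<close>


lemma matrix_mult_has_vector_derivative:
  fixes A :: "real^'n^'m"
  assumes "(f has_vector_derivative f') F"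
  shows "((\<lambda>s. A *v f s) has_vector_derivative A *v f') F"
  using bounded_linear.has_vector_derivative[OF matrix_vector_mul_bounded_linear assms] .

lemma skew_flow_norm:
  fixes A :: "real^'n^'n"
  assumes skew: "transpose A = - A"
    and u: "\<And>s. (u has_vector_derivative 2 *\<^sub>R (A *v u s)) (at s)"
  shows "norm (u s) = norm (u t)"
proof -
  have "((\<lambda>s. u s \<bullet> u s) has_real_derivative 0) (at r within UNIV)" for r
  proof -
    have "((\<lambda>s. u s \<bullet> u s) has_real_derivative
        u r \<bullet> (2 *\<^sub>R (A *v u r)) + (2 *\<^sub>R (A *v u r)) \<bullet> u r) (at r)"
      unfolding has_real_derivative_iff_has_vector_derivative
      by (rule bounded_bilinear.has_vector_derivative[OF bounded_bilinear_inner u u])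
    then show ?thesis by (simp add: skew_inner_self[OF skew] inner_commute)
  qed
  then obtain k where "\<And>s. u s \<bullet> u s = k"
    using has_field_derivative_zero_constant[of UNIV "\<lambda>s. u s \<bullet> u s"] by auto
  then show ?thesis by (simp add: norm_eq_sqrt_inner)
qed

text \<open>The difference of two flows is again a flow. Stated with norms, this gives uniqueness
  for equal initial values and the preservation of distances otherwise.\<close>

lemma skew_flow_unique:
  fixes A :: "real^'n^'n"
  assumes skew: "transpose A = - A"
    and u: "\<And>s. (u has_vector_derivative 2 *\<^sub>R (A *v u s)) (at s)"
    and w: "\<And>s. (w has_vector_derivative 2 *\<^sub>R (A *v w s)) (at s)"
  shows "norm (u s - w s) = norm (u t - w t)"
proof (rule skew_flow_norm[OF skew, of "\<lambda>s. u s - w s"])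
  fix r show "((\<lambda>s. u s - w s) has_vector_derivative 2 *\<^sub>R (A *v (u r - w r))) (at r)"
    using has_vector_derivative_diff[OF u w, of r]
    by (simp add: matrix_vector_mult_diff_distrib scaleR_diff_right)
qed

text \<open>For the difference D, the derivative of |D|^2 is 4 <D, (B - A)u>, since the term with
  \<open>A\<close> acting on D vanishes by skewness. All norms are constant along flows, so the mean
  value theorem suffices.\<close>

lemma skew_flow_perturbation:
  fixes A B :: "real^'n^'n"
  assumes A: "transpose A = - A" and B: "transpose B = - B"
    and u: "\<And>s. (u has_vector_derivative 2 *\<^sub>R (B *v u s)) (at s)"
    and w: "\<And>s. (w has_vector_derivative 2 *\<^sub>R (A *v w s)) (at s)"
    and init: "u 0 = w 0" and eps: "\<And>x. norm ((B - A) *v x) \<le> \<epsilon> * norm x" and s: "0 \<le> s" "s \<le> 1"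
  shows "norm (u s - w s) \<le> sqrt (8 * \<epsilon>) * norm (u 0)"
proof -
  define D where "D s = u s - w s" for s
  define n0 where "n0 = norm (u 0)"
  have nu: "norm (u s) = n0" and nw: "norm (w s) = n0" for s
    unfolding n0_def using skew_flow_norm[OF B u, of s 0] skew_flow_norm[OF A w, of s 0] init by auto
  have nD: "norm (D s) \<le> 2 * n0" for s
    unfolding D_def using norm_triangle_ineq4[of "u s" "w s"] nu nw by simp
  have deriv: "((\<lambda>s. D s \<bullet> D s) has_real_derivative 4 * (D r \<bullet> ((B - A) *v u r))) (at r)" for r
  proof -
    let ?d = "2 *\<^sub>R (B *v u r) - 2 *\<^sub>R (A *v w r)"
    have D: "(D has_vector_derivative ?d) (at r)"
      unfolding D_def by (rule has_vector_derivative_diff[OF u w])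
    have "((\<lambda>s. D s \<bullet> D s) has_real_derivative D r \<bullet> ?d + ?d \<bullet> D r) (at r)"
      unfolding has_real_derivative_iff_has_vector_derivative
      by (rule bounded_bilinear.has_vector_derivative[OF bounded_bilinear_inner D D])
    moreover have "?d = 2 *\<^sub>R ((B - A) *v u r) + 2 *\<^sub>R (A *v D r)"
      by (simp add: D_def algebra_simps)
    ultimately show ?thesis by (simp add: skew_inner_self[OF A] inner_add_right inner_commute)
  qed
  \<comment> \<open>The 8 is 4 times the 2 from the crude bound \<open>nD\<close>.\<close>
  have bound: "4 * (D r \<bullet> ((B - A) *v u r)) \<le> 8 * \<epsilon> * n0\<^sup>2" for r
  proof -
    have "D r \<bullet> ((B - A) *v u r) \<le> norm (D r) * norm ((B - A) *v u r)" by (rule norm_cauchy_schwarz)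
    also have "\<dots> \<le> (2 * n0) * (\<epsilon> * n0)"
      using eps[of "u r"] nu[of r] nD[of r] by (intro mult_mono) (auto simp: n0_def)
    finally show ?thesis by (simp add: power2_eq_square mult_ac)
  qed
  \<comment> \<open>The sign of \<open>\<epsilon>\<close> is known only through \<open>eps\<close>,
    applied to \<open>u 0\<close>.\<close>
  have n0: "0 \<le> 8 * \<epsilon> * n0\<^sup>2"
  proof -
    have "0 \<le> (\<epsilon> * n0) * n0"
      unfolding n0_def by (rule mult_nonneg_nonneg[OF order_trans[OF norm_ge_zero eps[of "u 0"]] norm_ge_zero])
    then show ?thesis by (simp add: power2_eq_square mult.assoc)
  qed
  have "D s \<bullet> D s \<le> 8 * \<epsilon> * n0\<^sup>2"
  proof (cases "s = 0")
    case True then show ?thesis using init n0 by (simp add: D_def)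
  next
    case False
    then obtain r where "D s \<bullet> D s - D 0 \<bullet> D 0 = (s - 0) * (4 * (D r \<bullet> ((B - A) *v u r)))"
      using MVT2[of 0 s "\<lambda>s. D s \<bullet> D s" "\<lambda>r. 4 * (D r \<bullet> ((B - A) *v u r))"] deriv s by force
    then have "D s \<bullet> D s = s * (4 * (D r \<bullet> ((B - A) *v u r)))" using init by (simp add: D_def)
    also have "\<dots> \<le> s * (8 * \<epsilon> * n0\<^sup>2)" using bound s by (intro mult_left_mono)
    also have "\<dots> \<le> 1 * (8 * \<epsilon> * n0\<^sup>2)" using n0 s by (intro mult_right_mono)
    finally show ?thesis by simp
  qed
  then have "norm (D s) \<le> sqrt (8 * \<epsilon> * n0\<^sup>2)" by (simp add: norm_eq_sqrt_inner)
  then show ?thesis by (simp add: real_sqrt_mult n0_def D_def)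
qed

section \<open>The exponential as a flow, and recovery of initial values from integrals\<close>

lemma mexp_flow_derivative:
  fixes A :: "real^'n^'n"
  assumes skew: "transpose A = - A"
  shows "((\<lambda>s. mexp ((2 * s) *\<^sub>R A) *v x) has_vector_derivative 2 *\<^sub>R (A *v (mexp ((2 * s) *\<^sub>R A) *v x))) (at s)"
  using skew
proof (induction x rule: rotation_pair_induct)
  case zero
  show ?case by simp
next
  case (add c a b x k)
  then show ?case
    by (auto intro!: derivative_eq_intros simp: algebra_simps)
next
  case (pair c a b)
  have "((\<lambda>s. cos (2 * s * c) *\<^sub>R a + sin (2 * s * c) *\<^sub>R b) has_vector_derivative
      (- sin (2 * s * c) * (2 * c)) *\<^sub>R a + (cos (2 * s * c) * (2 * c)) *\<^sub>R b) (at s)"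
    by (intro has_vector_derivative_comb) (auto intro!: derivative_eq_intros)
  then show ?case
    unfolding mexp_rotation_pair[OF skew pair]
    using pair by (simp add: rotation_pair_def algebra_simps)
qed

lemma flow_integrable:
  fixes u :: "real \<Rightarrow> real^'n"
  assumes u: "\<And>s. (u has_vector_derivative u' s) (at s)"
  shows "u integrable_on {a..b}"
  by (rule integrable_continuous_real)
    (meson continuous_at_imp_continuous_on has_vector_derivative_continuous u)

lemma integral_unit_diff_bound:
  fixes u w :: "real \<Rightarrow> 'a::banach"
  assumes "u integrable_on {0..s}" "w integrable_on {0..s}" "0 \<le> s" "s \<le> 1"
    and "\<And>r. 0 \<le> r \<Longrightarrow> r \<le> 1 \<Longrightarrow> norm (u r - w r) \<le> C"
  shows "norm (integral {0..s} u - integral {0..s} w) \<le> C"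
proof -
  have C: "0 \<le> C" using order_trans[OF norm_ge_zero assms(5)[of 0]] by simp
  have "norm (integral {0..s} (\<lambda>r. u r - w r)) \<le> integral {0..s} (\<lambda>r. C)"
    using assms by (intro integral_norm_bound_integral integrable_diff) auto
  also have "\<dots> = C * s" using assms by simp
  also have "\<dots> \<le> C * 1" using assms C by (intro mult_left_mono) auto
  finally show ?thesis using assms by (simp add: Henstock_Kurzweil_Integration.integral_diff)
qed

text \<open>The B-flow \<open>u\<close> is replaced by the A-flow with the same initial value at a
  cost of order sqrt(\<epsilon>); the coercivity of \<open>A\<close> then applies to the difference
  of two A-flows. With \<open>y\<close> equal to 0 it bounds \<open>u 0\<close> itself.\<close>

lemma perturbed_flow_coercive:
  fixes A B :: "real^'n^'n"
  assumes A: "transpose A = - A" and B: "transpose B = - B"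
    and K: "K > 0" "\<And>x. norm x \<le> K * norm (integral {0..1} (\<lambda>s. mexp ((2 * s) *\<^sub>R A) *v x))"
    and eps: "\<And>x. norm ((B - A) *v x) \<le> \<epsilon> * norm x"
    and y: "\<And>s. (y has_vector_derivative 2 *\<^sub>R (A *v y s)) (at s)"
    and u: "\<And>s. (u has_vector_derivative 2 *\<^sub>R (B *v u s)) (at s)"
  shows "norm (u 0 - y 0) \<le> K * (norm (integral {0..1} u - integral {0..1} y) + sqrt (8 * \<epsilon>) * norm (u 0))"
proof -
  let ?E = "\<lambda>s. mexp ((2 * s) *\<^sub>R A)"
  have E0: "?E 0 *v x = x" for x using mexp_zero_mult[OF A] by simp
  note dE = mexp_flow_derivative[OF A]
  have y_eq: "y s = ?E s *v y 0" for s
    using skew_flow_unique[OF A y dE[of "y 0"], of s 0] E0 by simp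
  have iE: "(\<lambda>s. ?E s *v x) integrable_on {0..1}" for x
    by (rule flow_integrable[OF dE])
  have iu: "u integrable_on {0..1}" by (rule flow_integrable[OF u])
  have "norm (integral {0..1} u - integral {0..1} (\<lambda>s. ?E s *v u 0)) \<le> sqrt (8 * \<epsilon>) * norm (u 0)"
    using skew_flow_perturbation[OF A B u dE[of "u 0"] _ eps] E0
    by (intro integral_unit_diff_bound iu iE) simp_all
  moreover have "integral {0..1} (\<lambda>s. ?E s *v (u 0 - y 0))
      = integral {0..1} (\<lambda>s. ?E s *v u 0) - integral {0..1} y"
    unfolding integral_cong[of "{0..1}", OF y_eq]
    by (simp only: matrix_vector_mult_diff_distrib Henstock_Kurzweil_Integration.integral_diff[OF iE iE])
  ultimately have "norm (integral {0..1} (\<lambda>s. ?E s *v (u 0 - y 0)))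
     \<le> norm (integral {0..1} u - integral {0..1} y) + sqrt (8 * \<epsilon>) * norm (u 0)"
    using norm_triangle_ineq4[of "integral {0..1} u - integral {0..1} y"
        "integral {0..1} u - integral {0..1} (\<lambda>s. ?E s *v u 0)"] by simp
  then show ?thesis using K(1) by (intro order_trans[OF K(2)[of "u 0 - y 0"]] mult_left_mono) auto
qed

text \<open>A resonant pair of \<open>B\<close> would yield a flow with integral 0 over the unit
  interval, and coercivity would bound its initial value by half of itself.\<close>

lemma nonresonant_perturbation:
  fixes A B :: "real^'n^'n"
  assumes A: "transpose A = - A" and B: "transpose B = - B"
    and K: "K > 0" "\<And>x. norm x \<le> K * norm (integral {0..1} (\<lambda>s. mexp ((2 * s) *\<^sub>R A) *v x))"
    and eps: "\<And>x. norm ((B - A) *v x) \<le> \<epsilon> * norm x" and small: "K * sqrt (8 * \<epsilon>) \<le> 1 / 2"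
  shows "nonresonant B"
  unfolding nonresonant_def
proof (intro allI impI notI)
  fix c a b assume pair: "rotation_pair B c a b" and a: "a \<noteq> 0" and c: "c \<noteq> 0" and sc: "sin c = 0"
  let ?u = "\<lambda>s. mexp ((2 * s) *\<^sub>R B) *v a"
  define P where "P s = (sin (2 * s * c) / (2 * c)) *\<^sub>R a + (- cos (2 * s * c) / (2 * c)) *\<^sub>R b" for s
  have "(?u has_integral P 1 - P 0) {0..1}"
  proof (rule fundamental_theorem_of_calculus)
    fix s :: real
    show "(P has_vector_derivative ?u s) (at s within {0..1})"
      unfolding P_def mexp_rotation_pair[OF B pair] using c
      by (intro has_vector_derivative_comb) (auto intro!: derivative_eq_intros)
  qed simp
  \<comment> \<open>The total angle 2c is a multiple of 2 pi.\<close>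
  moreover have "P 1 = P 0"
    using sc by (simp add: P_def sin_double cos_double_sin)
  ultimately have "integral {0..1} ?u = 0" by (simp add: integral_unique)
  moreover have "?u 0 = a" using mexp_zero_mult[OF B] by simp
  ultimately have "norm a \<le> K * (sqrt (8 * \<epsilon>) * norm a)"
    using perturbed_flow_coercive[OF A B K eps _ mexp_flow_derivative[OF B], of "\<lambda>s. 0" a] by simp
  also have "\<dots> \<le> 1 / 2 * norm a" using mult_right_mono[OF small, of "norm a"] by (simp add: mult_ac)
  finally show False using a by simp
qed

section \<open>Comparison of two parameters\<close>


lemma calV_nonresonant:
  fixes Us :: "'m::finite \<Rightarrow> real^'q::finite^'q"
  assumes V: "\<theta> \<in> calV Us"
  shows "nonresonant (Ut Us \<theta>)"
proof -
  let ?A = "Ut Us \<theta>"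
  have pos: False if pair: "rotation_pair ?A c a b" and "a \<noteq> 0" and k: "c = real k * pi" "k \<ge> 1" for c a b k
  proof -
    let ?v = "cvec a + (1 * \<i>) *s cvec b"
    let ?M = "mat (complex_of_real (real k * pi)) - Uc Us \<theta>"
    have "mat z *v v = z *s v" for z :: complex and v :: "complex^'q"
      by (simp add: matrix_vector_mult_def mat_def vec_eq_iff if_distrib[of "\<lambda>x. x * _"] cong: if_cong)
    then have "?M *v ?v = 0"
      using i_cmat_eigenvector[OF pair, of 1] unfolding Uc_eq matrix_vector_mult_diff_rdistrib
      by (simp add: k)
    moreover have "?v \<noteq> 0"
    proof -
      obtain i where "a $ i \<noteq> 0" using \<open>a \<noteq> 0\<close> by (auto simp: vec_eq_iff)
      then have "Re (?v $ i) \<noteq> 0" by (simp add: cvec_def)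
      then show ?thesis by (metis zero_complex.sel(1) zero_index)
    qed
    ultimately have "\<not> invertible ?M"
      unfolding invertible_left_inverse matrix_left_invertible_ker by blast
    then show False using V k(2) by (simp add: invertible_det_nz calV_def)
  qed
  show ?thesis
    unfolding nonresonant_def
  proof (intro allI impI notI)
    fix c a b assume pair: "rotation_pair ?A c a b" and a: "a \<noteq> 0" and c: "c \<noteq> 0" and sc: "sin c = 0"
    obtain i :: int where i: "c = real_of_int i * pi" using sc by (auto simp: sin_zero_iff_int2)
    with c have "i \<noteq> 0" by auto
    \<comment> \<open>\<open>calV\<close> only speaks of positive multiples of pi; negative ones are
      reached by flipping the sign of the partner.\<close>
    have neg: "rotation_pair ?A (- c) a (- b)"
      using pair matrix_vector_mult_diff_distrib[of ?A 0 b] by (simp add: rotation_pair_def)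
    show False
    proof (cases "i > 0")
      case True
      then show False using pos[OF pair a, of "nat i"] i by (simp add: Suc_le_eq)
    next
      case False
      then show False using pos[OF neg a, of "nat (- i)"] i \<open>i \<noteq> 0\<close> by (simp add: Suc_le_eq)
    qed
  qed
qed

section \<open>Dependence of the matrix on the parameter\<close>

lemma Ut_mult: "Ut Us h *v x = (\<Sum>j\<in>UNIV. h $ j *\<^sub>R (Us j *v x))"
proof -
  have "(\<Sum>j\<in>J. h $ j *\<^sub>R Us j) *v x = (\<Sum>j\<in>J. h $ j *\<^sub>R (Us j *v x))" if "finite J" for J
    using that by (induction J) (simp_all add: algebra_simps scaleR_matrix_vector_assoc)
  then show ?thesis by (simp add: Ut_def)
qed

lemma Ut_skew:
  assumes "\<And>j. transpose (Us j) = - Us j"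
  shows "transpose (Ut Us \<theta>) = - Ut Us \<theta>"
proof -
  have "\<theta> $ j * Us j $ l $ k = - (\<theta> $ j * Us j $ k $ l)" for j k l
    using arg_cong[OF assms[of j], of "\<lambda>X. X $ k $ l"] by (simp add: transpose_def)
  then have sw: "(\<Sum>j\<in>UNIV. \<theta> $ j * Us j $ l $ k) = - (\<Sum>j\<in>UNIV. \<theta> $ j * Us j $ k $ l)" for k l
    unfolding sum_negf[symmetric] by (rule sum.cong[OF refl])
  have "transpose (Ut Us \<theta>) $ k $ l = (- Ut Us \<theta>) $ k $ l" for k l
    unfolding Ut_def transpose_def using sw[of l k] by simp
  then show ?thesis by (simp add: vec_eq_iff)
qed

lemma Ut_diff: "Ut Us \<theta> - Ut Us \<theta>' = Ut Us (\<theta> - \<theta>')"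
  by (simp add: Ut_def sum_subtractf[symmetric] scaleR_diff_left)

lemma Ut_bound:
  fixes Us :: "'m::finite \<Rightarrow> real^'q::finite^'q"
  obtains C where "C > 0" "\<And>h x. norm (Ut Us h *v x) \<le> C * norm h * norm x"
proof -
  define C where "C = 1 + (\<Sum>j\<in>UNIV. onorm ((*v) (Us j)))"
  have pos: "0 \<le> onorm ((*v) (Us j))" for j
    by (rule onorm_pos_le[OF matrix_vector_mul_bounded_linear])
  have "C > 0" unfolding C_def using sum_nonneg[of UNIV "\<lambda>j. onorm ((*v) (Us j))"] pos by force
  moreover have "norm (Ut Us h *v x) \<le> C * norm h * norm x" for h x
  proof -
    have "norm (Ut Us h *v x) \<le> (\<Sum>j\<in>UNIV. norm (h $ j *\<^sub>R (Us j *v x)))"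
      unfolding Ut_mult by (rule norm_sum)
    also have "\<dots> \<le> (\<Sum>j\<in>UNIV. norm h * (onorm ((*v) (Us j)) * norm x))"
    proof (rule sum_mono)
      fix j
      show "norm (h $ j *\<^sub>R (Us j *v x)) \<le> norm h * (onorm ((*v) (Us j)) * norm x)"
        unfolding norm_scaleR
        by (intro mult_mono onorm[OF matrix_vector_mul_bounded_linear])
          (auto simp: component_le_norm_cart)
    qed
    also have "\<dots> = (C - 1) * norm h * norm x"
      by (simp add: C_def sum_distrib_left sum_distrib_right mult_ac)
    also have "\<dots> \<le> C * norm h * norm x" by (intro mult_right_mono) auto
    finally show ?thesis .
  qed
  ultimately show thesis using that by blast
qed

lemma UU_inner: "UU Us x y \<bullet> h = (Ut Us h *v x) \<bullet> y"
  unfolding Ut_mult by (simp add: UU_def inner_vec_def[of _ h] inner_sum_left mult.commute)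

lemma continuous_on_UU:
  assumes "continuous_on S f" "continuous_on S g"
  shows "continuous_on S (\<lambda>s. UU Us (f s) (g s))"
  unfolding UU_def
  by (intro continuous_on_vec_lambda continuous_on_inner assms
      bounded_linear.continuous_on[OF matrix_vector_mul_bounded_linear])

context
  fixes Us :: "'m::finite \<Rightarrow> real^'q::finite^'q"
  assumes skew: "\<And>j. transpose (Us j) = - Us j"
begin

text \<open>The integrand is the derivative of
  \<open>\<langle>z', y\<rangle> - \<langle>y', z\<rangle> + 2 \<langle>z, B y\<rangle>\<close>, where \<open>y\<close>, \<open>z\<close> are the curves of
  parameters \<open>\<theta>\<close>, \<open>\<theta>'\<close> and \<open>B\<close> is the matrix of \<open>\<theta>'\<close>.\<close>

lemma z_cot_difference:
  assumes nr: "nonresonant (Ut Us \<theta>)" and nr': "nonresonant (Ut Us \<theta>')"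
  shows "((\<lambda>s. 2 * (geo_point Us \<theta>' x s \<bullet> (Ut Us (\<theta>' - \<theta>) *v geo_velocity Us \<theta> x s)))
     has_integral Uapply Us z_cot \<theta>' x \<bullet> x - Uapply Us z_cot \<theta> x \<bullet> x) {0..1}"
proof -
  let ?A = "Ut Us \<theta>" and ?B = "Ut Us \<theta>'"
  have A: "transpose ?A = - ?A" and B: "transpose ?B = - ?B" by (simp_all add: Ut_skew skew)
  define y where "y = geo_point Us \<theta> x"
  define z where "z = geo_point Us \<theta>' x"
  define v where "v = geo_velocity Us \<theta> x"
  define w where "w = geo_velocity Us \<theta>' x"
  have y: "(y has_vector_derivative v s) (at s)" for s
    unfolding y_def v_def by (rule geo_point_derivative[OF A nr])
  have z: "(z has_vector_derivative w s) (at s)" for s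
    unfolding z_def w_def by (rule geo_point_derivative[OF B nr'])
  have v: "(v has_vector_derivative 2 *\<^sub>R (?A *v v s)) (at s)" for s
    unfolding v_def by (rule geo_velocity_derivative[OF A])
  have w: "(w has_vector_derivative 2 *\<^sub>R (?B *v w s)) (at s)" for s
    unfolding w_def by (rule geo_velocity_derivative[OF B])
  define G where "G s = w s \<bullet> y s - v s \<bullet> z s + 2 *\<^sub>R (z s \<bullet> (?B *v y s))" for s
  note d = bounded_bilinear.has_vector_derivative[OF bounded_bilinear_inner]
  have "(G has_vector_derivative (w s \<bullet> v s + (2 *\<^sub>R (?B *v w s)) \<bullet> y s)
      - (v s \<bullet> w s + (2 *\<^sub>R (?A *v v s)) \<bullet> z s)
      + 2 *\<^sub>R (z s \<bullet> (?B *v v s) + w s \<bullet> (?B *v y s))) (at s)" for s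
    unfolding G_def
    by (intro has_vector_derivative_add has_vector_derivative_diff d w y v z
        bounded_linear.has_vector_derivative[OF bounded_linear_scaleR_right] matrix_mult_has_vector_derivative)
  moreover have "(w s \<bullet> v s + (2 *\<^sub>R (?B *v w s)) \<bullet> y s)
      - (v s \<bullet> w s + (2 *\<^sub>R (?A *v v s)) \<bullet> z s)
      + 2 *\<^sub>R (z s \<bullet> (?B *v v s) + w s \<bullet> (?B *v y s))
     = 2 * (z s \<bullet> (Ut Us (\<theta>' - \<theta>) *v v s))" for s
    unfolding Ut_diff[symmetric] using skew_inner[OF B, of "w s" "y s"]
    by (simp add: inner_commute matrix_vector_mult_diff_rdistrib inner_diff_left algebra_simps)
  ultimately have "((\<lambda>s. 2 * (z s \<bullet> (Ut Us (\<theta>' - \<theta>) *v v s))) has_integral G 1 - G 0) {0..1}"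
    by (intro fundamental_theorem_of_calculus) (auto intro: has_vector_derivative_at_within)
  moreover have "G 0 = 0"
    by (simp add: G_def y_def z_def geo_point_0[OF A nr] geo_point_0[OF B nr'])
  \<comment> \<open>Both curves end in \<open>x\<close>, so \<open>geo_velocity_1\<close> applies to
    each; the remaining quadratic terms vanish by skewness.\<close>
  moreover have "G 1 = Uapply Us z_cot \<theta>' x \<bullet> x - Uapply Us z_cot \<theta> x \<bullet> x"
    by (simp add: G_def y_def z_def v_def w_def geo_point_1[OF A nr] geo_point_1[OF B nr']
        geo_velocity_1[OF A nr] geo_velocity_1[OF B nr'] inner_add_left skew_inner[OF A] skew_inner[OF B]
        skew_inner_self[OF A] skew_inner_self[OF B])
  ultimately show ?thesis by (simp add: z_def v_def)
qed

end

section \<open>The derivative of the phase function\<close>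


lemma geo_continuous:
  fixes Us :: "'m::finite \<Rightarrow> real^'q::finite^'q"
  assumes A: "transpose (Ut Us \<theta>) = - Ut Us \<theta>" and nr: "nonresonant (Ut Us \<theta>)"
  shows "continuous_on S (geo_point Us \<theta> x)" "continuous_on S (geo_velocity Us \<theta> x)"
  using geo_point_derivative[OF A nr] geo_velocity_derivative[OF A]
  by (meson continuous_at_imp_continuous_on has_vector_derivative_continuous)+

lemma geo_velocity_has_integral:
  fixes Us :: "'m::finite \<Rightarrow> real^'q::finite^'q"
  assumes A: "transpose (Ut Us \<theta>) = - Ut Us \<theta>" and nr: "nonresonant (Ut Us \<theta>)" and "0 \<le> s"
  shows "(geo_velocity Us \<theta> x has_integral geo_point Us \<theta> x s) {0..s}"
  using fundamental_theorem_of_calculus[of 0 s "geo_point Us \<theta> x" "geo_velocity Us \<theta> x"]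
    geo_point_derivative[OF A nr] geo_point_0[OF A nr] assms(3)
  by (simp add: has_vector_derivative_at_within)

text \<open>Both velocities are flows with the same integral \<open>x\<close> over the unit
  interval, so their initial values are close by coercivity; the flows then stay close, and so do
  their integrals from 0.\<close>

lemma geo_point_perturbation:
  fixes Us :: "'m::finite \<Rightarrow> real^'q::finite^'q"
  assumes A: "transpose (Ut Us \<theta>) = - Ut Us \<theta>" and B: "transpose (Ut Us \<theta>') = - Ut Us \<theta>'"
    and nr: "nonresonant (Ut Us \<theta>)"
    and K: "K > 0" "\<And>x. norm x \<le> K * norm (integral {0..1} (\<lambda>s. mexp ((2 * s) *\<^sub>R Ut Us \<theta>) *v x))"
    and eps: "\<And>x. norm ((Ut Us \<theta>' - Ut Us \<theta>) *v x) \<le> \<epsilon> * norm x" and small: "K * sqrt (8 * \<epsilon>) \<le> 1 / 2"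
    and s: "0 \<le> s" "s \<le> 1"
  shows "norm (geo_point Us \<theta>' x s - geo_point Us \<theta> x s) \<le> sqrt (8 * \<epsilon>) * (2 * K * norm x) * (1 + K)"
proof -
  have nr': "nonresonant (Ut Us \<theta>')" by (rule nonresonant_perturbation[OF A B K eps small])
  define v where "v = geo_velocity Us \<theta> x"
  define w where "w = geo_velocity Us \<theta>' x"
  have v: "(v has_vector_derivative 2 *\<^sub>R (Ut Us \<theta> *v v s)) (at s)" for s
    unfolding v_def by (rule geo_velocity_derivative[OF A])
  have w: "(w has_vector_derivative 2 *\<^sub>R (Ut Us \<theta>' *v w s)) (at s)" for s
    unfolding w_def by (rule geo_velocity_derivative[OF B])
  have iv: "(v has_integral geo_point Us \<theta> x s) {0..s}" and iw: "(w has_integral geo_point Us \<theta>' x s) {0..s}"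
    if "0 \<le> s" for s
    unfolding v_def w_def using geo_velocity_has_integral[OF A nr that] geo_velocity_has_integral[OF B nr' that]
    by auto
  have int1: "integral {0..1} v = x" "integral {0..1} w = x"
    using iv[of 1] iw[of 1] by (simp_all add: integral_unique geo_point_1[OF A nr] geo_point_1[OF B nr'])
  define e where "e = sqrt (8 * \<epsilon>)"
  have e0: "0 \<le> e"
  proof (cases "\<epsilon> \<ge> 0")
    \<comment> \<open>A negative \<open>\<epsilon>\<close> would make \<open>eps\<close> kill every
      vector.\<close>
    case False
    then have "\<epsilon> * norm y < 0 \<or> y = 0" for y :: "real^'q" by (simp add: mult_less_0_iff)
    then have "y = 0" for y :: "real^'q" using order_trans[OF norm_ge_zero eps[of y]] by (metis not_less)
    then show ?thesis by (metis zero_neq_one vec_component zero_index)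
  qed (simp add: e_def)
  \<comment> \<open>Comparison with the zero flow; \<open>small\<close> then absorbs the last term
    into the left side.\<close>
  have "norm (w 0) \<le> K * (norm x + e * norm (w 0))"
    using perturbed_flow_coercive[OF A B K eps _ w, of "\<lambda>s. 0"] int1 by (simp add: e_def)
  also have "\<dots> = K * norm x + (K * e) * norm (w 0)" by (simp add: algebra_simps)
  also have "\<dots> \<le> K * norm x + (1 / 2) * norm (w 0)"
    using small by (intro add_left_mono mult_right_mono) (auto simp: e_def)
  finally have w0: "norm (w 0) \<le> 2 * K * norm x" by simp
  have wv0: "norm (w 0 - v 0) \<le> K * (e * norm (w 0))"
    using perturbed_flow_coercive[OF A B K eps v w] int1 by (simp add: e_def)
  \<comment> \<open>An intermediate flow: it shares its matrix with \<open>v\<close> and its initial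
    value with \<open>w\<close>.\<close>
  let ?E = "\<lambda>s. mexp ((2 * s) *\<^sub>R Ut Us \<theta>) *v w 0"
  have E0: "?E 0 = w 0" using mexp_zero_mult[OF A] by simp
  note dE = mexp_flow_derivative[OF A, of "w 0"]
  have bound: "norm (w r - v r) \<le> e * (2 * K * norm x) * (1 + K)" if "0 \<le> r" "r \<le> 1" for r
  proof -
    have "norm (w r - ?E r) \<le> e * norm (w 0)"
      unfolding e_def using skew_flow_perturbation[OF A B w dE _ eps that] E0 by simp
    moreover have "norm (?E r - v r) = norm (w 0 - v 0)"
      using skew_flow_unique[OF A dE v, of r 0] E0 by simp
    ultimately have "norm (w r - v r) \<le> e * norm (w 0) + K * (e * norm (w 0))"
      using wv0 norm_triangle_ineq[of "w r - ?E r" "?E r - v r"] by simp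
    also have "\<dots> = e * norm (w 0) * (1 + K)" by (simp add: algebra_simps)
    also have "\<dots> \<le> e * (2 * K * norm x) * (1 + K)"
      using w0 e0 K(1) by (intro mult_right_mono mult_left_mono) auto
    finally show ?thesis .
  qed
  have "norm (integral {0..s} w - integral {0..s} v) \<le> e * (2 * K * norm x) * (1 + K)"
    using bound iv[OF s(1)] iw[OF s(1)] by (intro integral_unit_diff_bound s) (auto intro: has_integral_integrable)
  then show ?thesis using iv[OF s(1)] iw[OF s(1)] by (simp add: integral_unique e_def)
qed

lemma UU_integrable:
  fixes Us :: "'m::finite \<Rightarrow> real^'q::finite^'q"
  assumes A: "transpose (Ut Us \<theta>) = - Ut Us \<theta>" and nr: "nonresonant (Ut Us \<theta>)"
  shows "(\<lambda>s. UU Us (geo_point Us \<theta> x s) (geo_velocity Us \<theta> x s)) integrable_on {a..b}"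
  by (intro integrable_continuous_real continuous_on_UU geo_continuous A nr)

lemma UU_integral_inner:
  fixes Us :: "'m::finite \<Rightarrow> real^'q::finite^'q"
  assumes A: "transpose (Ut Us \<theta>) = - Ut Us \<theta>" and nr: "nonresonant (Ut Us \<theta>)"
  shows "((\<lambda>s. (Ut Us h *v geo_point Us \<theta> x s) \<bullet> geo_velocity Us \<theta> x s) has_integral
     integral {0..1} (\<lambda>s. UU Us (geo_point Us \<theta> x s) (geo_velocity Us \<theta> x s)) \<bullet> h) {0..1}"
  using has_integral_linear[OF integrable_integral[OF UU_integrable[OF A nr]] bounded_linear_inner_left[of h]]
  by (simp add: o_def UU_inner)

text \<open>The exact formula \<open>z_cot_difference\<close> already carries a factor linear in the
  increment h. Replacing its first curve by the one for \<open>\<theta>\<close> costs only O(sqrt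
  |h|), so the remainder is of order |h|^(3/2).\<close>

lemma phi_has_derivative:
  fixes Us :: "'m::finite \<Rightarrow> real^'q::finite^'q"
  assumes skew: "\<And>j. transpose (Us j) = - Us j" and nr: "nonresonant (Ut Us \<theta>)"
    and T: "T = (1/2) *\<^sub>R integral {0..1} (\<lambda>s. UU Us (geo_point Us \<theta> x s) (geo_velocity Us \<theta> x s))"
  shows "((\<lambda>\<theta>. phi Us (x, t) \<theta>) has_derivative (\<lambda>h. 4 * ((t - T) \<bullet> h))) (at \<theta>)"
proof -
  define F where "F \<theta> = Uapply Us z_cot \<theta> x \<bullet> x" for \<theta>
  have A: "transpose (Ut Us \<theta>) = - Ut Us \<theta>" for \<theta> by (rule Ut_skew[OF skew])
  obtain K where K: "K > 0" "\<And>x. norm x \<le> K * norm (integral {0..1} (\<lambda>s. mexp ((2 * s) *\<^sub>R Ut Us \<theta>) *v x))"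
    using flow_integral_coercive[OF A nr] by blast
  obtain C where C: "C > 0" "\<And>h x. norm (Ut Us h *v x) \<le> C * norm h * norm x"
    using Ut_bound[of Us] by blast
  define y where "y = geo_point Us \<theta> x"
  define v where "v = geo_velocity Us \<theta> x"
  define V where "V = norm (v 0)"
  have nv: "norm (v s) = V" for s
    unfolding V_def v_def by (rule skew_flow_norm[OF A geo_velocity_derivative[OF A]])
  \<comment> \<open>The sign comes from skewness, the 4 from the factor 2 and the 1/2 in
    \<open>T\<close>.\<close>
  have iT: "((\<lambda>s. 2 * (y s \<bullet> (Ut Us h *v v s))) has_integral - (4 * (T \<bullet> h))) {0..1}" for h
    using has_integral_mult_right[OF UU_integral_inner[OF A nr, of h x], of "-2"]
    by (simp add: T y_def v_def skew_inner[OF A])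
  define Q where "Q = 2 * C * V * (2 * K * norm x) * (1 + K)"
  have Q: "0 \<le> Q" using K C by (simp add: Q_def V_def)
  have est: "\<bar>F \<theta>' - F \<theta> + 4 * (T \<bullet> (\<theta>' - \<theta>))\<bar> \<le> Q * sqrt (8 * (C * norm (\<theta>' - \<theta>))) * norm (\<theta>' - \<theta>)"
    if small: "K * sqrt (8 * (C * norm (\<theta>' - \<theta>))) \<le> 1 / 2" for \<theta>'
  proof -
    define h where "h = \<theta>' - \<theta>"
    let ?z = "geo_point Us \<theta>' x"
    let ?e = "sqrt (8 * (C * norm h))"
    have eps: "norm ((Ut Us \<theta>' - Ut Us \<theta>) *v x) \<le> (C * norm (\<theta>' - \<theta>)) * norm x" for x
      unfolding Ut_diff by (rule C(2))
    have nr': "nonresonant (Ut Us \<theta>')" by (rule nonresonant_perturbation[OF A A K eps small])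
    have iz: "((\<lambda>s. 2 * (?z s \<bullet> (Ut Us h *v v s))) has_integral F \<theta>' - F \<theta>) {0..1}"
      unfolding F_def h_def v_def by (rule z_cot_difference[OF skew nr nr'])
    have "\<bar>2 * (?z s \<bullet> (Ut Us h *v v s)) - 2 * (y s \<bullet> (Ut Us h *v v s))\<bar> \<le> Q * ?e * norm h"
      if s: "0 \<le> s" "s \<le> 1" for s
    proof -
      have "\<bar>2 * (?z s \<bullet> (Ut Us h *v v s)) - 2 * (y s \<bullet> (Ut Us h *v v s))\<bar>
          = 2 * \<bar>(?z s - y s) \<bullet> (Ut Us h *v v s)\<bar>"
        by (simp add: inner_diff_left abs_if)
      also have "\<dots> \<le> 2 * (norm (?z s - y s) * norm (Ut Us h *v v s))"
        by (intro mult_left_mono Cauchy_Schwarz_ineq2) simp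
      also have "\<dots> \<le> 2 * ((?e * (2 * K * norm x) * (1 + K)) * (C * norm h * V))"
        unfolding y_def h_def using geo_point_perturbation[OF A A nr K eps small s, of x] C(2)[of "\<theta>' - \<theta>" "v s"] C(1) K(1)
        by (intro mult_left_mono mult_mono) (auto simp: nv)
      also have "\<dots> = Q * ?e * norm h" by (simp add: Q_def)
      finally show ?thesis .
    qed
    then have "norm (integral {0..1} (\<lambda>s. 2 * (?z s \<bullet> (Ut Us h *v v s))) - integral {0..1} (\<lambda>s. 2 * (y s \<bullet> (Ut Us h *v v s))))
        \<le> Q * ?e * norm h"
      using iz iT[of h] by (intro integral_unit_diff_bound) (auto intro: has_integral_integrable)
    then show ?thesis unfolding integral_unique[OF iz] integral_unique[OF iT] by (simp add: h_def)
  qed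
  have "(F has_derivative (\<lambda>h. - (4 * (T \<bullet> h)))) (at \<theta>)"
    unfolding has_derivative_at_alt
  proof (intro conjI allI impI)
    show "bounded_linear (\<lambda>h. - (4 * (T \<bullet> h)))"
      by (intro bounded_linear_minus bounded_linear_const_mult bounded_linear_inner_right)
    fix e :: real assume e: "0 < e"
    \<comment> \<open>The first bound makes \<open>est\<close> applicable, the second keeps
      \<open>Q * n\<close> below \<open>e\<close>; \<open>Q + 1\<close> avoids dividing by
      0.\<close>
    define n where "n = min (1 / (2 * K)) (e / (Q + 1))"
    have n: "n > 0" using K e Q by (simp add: n_def)
    show "\<exists>d>0. \<forall>\<theta>'. norm (\<theta>' - \<theta>) < d \<longrightarrow> norm (F \<theta>' - F \<theta> - - (4 * (T \<bullet> (\<theta>' - \<theta>)))) \<le> e * norm (\<theta>' - \<theta>)"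
    \<comment> \<open>The radius at which
      \<open>sqrt (8 * (C * norm (\<theta>' - \<theta>)))\<close> equals \<open>n\<close>.\<close>
    proof (intro exI[of _ "n\<^sup>2 / (8 * C)"] conjI allI impI)
      show "0 < n\<^sup>2 / (8 * C)" using n C by simp
      fix \<theta>' assume "norm (\<theta>' - \<theta>) < n\<^sup>2 / (8 * C)"
      then have "8 * (C * norm (\<theta>' - \<theta>)) \<le> n\<^sup>2" using C by (simp add: field_simps)
      then have sq: "sqrt (8 * (C * norm (\<theta>' - \<theta>))) \<le> n" using n by (intro real_le_lsqrt) (auto simp: C less_imp_le)
      have "K * sqrt (8 * (C * norm (\<theta>' - \<theta>))) \<le> K * (1 / (2 * K))"
        using sq K by (intro mult_left_mono) (auto simp: n_def)
      then have "\<bar>F \<theta>' - F \<theta> + 4 * (T \<bullet> (\<theta>' - \<theta>))\<bar> \<le> Q * sqrt (8 * (C * norm (\<theta>' - \<theta>))) * norm (\<theta>' - \<theta>)"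
        using K by (intro est) simp
      also have "\<dots> \<le> e * norm (\<theta>' - \<theta>)"
      proof (rule mult_right_mono)
        have "Q * sqrt (8 * (C * norm (\<theta>' - \<theta>))) \<le> (Q + 1) * (e / (Q + 1))"
          using sq Q n C by (intro mult_mono) (auto simp: n_def)
        then show "Q * sqrt (8 * (C * norm (\<theta>' - \<theta>))) \<le> e" using Q by simp
      qed simp
      finally show "norm (F \<theta>' - F \<theta> - - (4 * (T \<bullet> (\<theta>' - \<theta>)))) \<le> e * norm (\<theta>' - \<theta>)" by simp
    qed
  qed
  moreover have "((\<lambda>\<theta>. 4 * (t \<bullet> \<theta>)) has_derivative (\<lambda>h. 4 * (t \<bullet> h))) (at \<theta>)"
    by (intro derivative_eq_intros refl) auto
  ultimately have "((\<lambda>\<theta>. F \<theta> + 4 * (t \<bullet> \<theta>)) has_derivative (\<lambda>h. - (4 * (T \<bullet> h)) + 4 * (t \<bullet> h))) (at \<theta>)"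
    by (rule has_derivative_add)
  then show ?thesis by (simp add: phi_def F_def inner_diff_left algebra_simps)
qed

text \<open>The velocity has constant norm, equal to that of
  \<open>Uapply Us z_over_sin \<theta> x\<close>, its value at s = 1/2. Integrating the derivative
  of <velocity, point> gives this squared norm minus 4 <T, \<theta>>, while the end values give the
  z cot z term of \<open>phi\<close>.\<close>

lemma phi_eq_velocity_norm:
  fixes Us :: "'m::finite \<Rightarrow> real^'q::finite^'q"
  assumes skew: "\<And>j. transpose (Us j) = - Us j" and nr: "nonresonant (Ut Us \<theta>)"
    and T: "T = (1/2) *\<^sub>R integral {0..1} (\<lambda>s. UU Us (geo_point Us \<theta> x s) (geo_velocity Us \<theta> x s))"
  shows "phi Us (x, T) \<theta> = (norm (Uapply Us z_over_sin \<theta> x))\<^sup>2"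
proof -
  have A: "transpose (Ut Us \<theta>) = - Ut Us \<theta>" by (rule Ut_skew[OF skew])
  let ?y = "geo_point Us \<theta> x" and ?v = "geo_velocity Us \<theta> x"
  define N where "N = (norm (Uapply Us z_over_sin \<theta> x))\<^sup>2"
  have N: "?v s \<bullet> ?v s = N" for s
    using skew_flow_norm[OF A geo_velocity_derivative[OF A], of x s "1/2"]
    by (simp add: N_def dot_square_norm geo_velocity_half[OF A])
  have "((\<lambda>s. ?v s \<bullet> ?y s) has_vector_derivative ?v s \<bullet> ?v s + (2 *\<^sub>R (Ut Us \<theta> *v ?v s)) \<bullet> ?y s) (at s)" for s
    by (rule bounded_bilinear.has_vector_derivative[OF bounded_bilinear_inner
          geo_velocity_derivative[OF A] geo_point_derivative[OF A nr]])
  moreover have "?v s \<bullet> ?v s + (2 *\<^sub>R (Ut Us \<theta> *v ?v s)) \<bullet> ?y s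
      = N - 2 * ((Ut Us \<theta> *v ?y s) \<bullet> ?v s)" for s
    unfolding N using skew_inner[OF A, of "?v s" "?y s"] by (simp add: inner_commute)
  ultimately have "((\<lambda>s. N - 2 * ((Ut Us \<theta> *v ?y s) \<bullet> ?v s)) has_integral ?v 1 \<bullet> ?y 1 - ?v 0 \<bullet> ?y 0) {0..1}"
    by (intro fundamental_theorem_of_calculus) (auto intro: has_vector_derivative_at_within)
  moreover have "((\<lambda>s. N - 2 * ((Ut Us \<theta> *v ?y s) \<bullet> ?v s)) has_integral N - 2 * ((2 *\<^sub>R T) \<bullet> \<theta>)) {0..1}"
    using has_integral_diff[OF has_integral_const_real[of N 0 1] has_integral_mult_right[OF UU_integral_inner[OF A nr], of 2]]
    by (simp add: T)
  ultimately have "?v 1 \<bullet> ?y 1 - ?v 0 \<bullet> ?y 0 = N - 2 * ((2 *\<^sub>R T) \<bullet> \<theta>)"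
    by (rule has_integral_unique)
  then show ?thesis
    by (simp add: geo_point_0[OF A nr] geo_point_1[OF A nr] geo_velocity_1[OF A nr] inner_add_left
        skew_inner[OF A] skew_inner_self[OF A] phi_def N_def)
qed

section \<open>Absolute continuity and length\<close>


lemma abs_cont_on_Lipschitz:
  fixes f :: "real \<Rightarrow> 'b::metric_space"
  assumes L: "L > 0"
    and lip: "\<And>s t. a \<le> s \<Longrightarrow> s \<le> t \<Longrightarrow> t \<le> b \<Longrightarrow> dist (f t) (f s) \<le> L * (t - s)"
  shows "abs_cont_on a b f"
  unfolding abs_cont_on_def
proof (intro allI impI)
  fix e :: real assume e: "e > 0"
  show "\<exists>d>0. \<forall>(n::nat) l r.
        (\<forall>i<n. a \<le> l i \<and> l i \<le> r i \<and> r i \<le> b) \<and>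
        (\<forall>i<n. \<forall>j<n. i \<noteq> j \<longrightarrow> r i \<le> l j \<or> r j \<le> l i) \<and>
        (\<Sum>i<n. r i - l i) < d \<longrightarrow> (\<Sum>i<n. dist (f (r i)) (f (l i))) < e"
  proof (intro exI[of _ "e / L"] conjI allI impI)
    show "e / L > 0" using e L by simp
    fix n :: nat and l r :: "nat \<Rightarrow> real"
    assume H: "(\<forall>i<n. a \<le> l i \<and> l i \<le> r i \<and> r i \<le> b) \<and>
        (\<forall>i<n. \<forall>j<n. i \<noteq> j \<longrightarrow> r i \<le> l j \<or> r j \<le> l i) \<and> (\<Sum>i<n. r i - l i) < e / L"
    have "(\<Sum>i<n. dist (f (r i)) (f (l i))) \<le> (\<Sum>i<n. L * (r i - l i))"
      using H by (intro sum_mono lip) auto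
    also have "\<dots> = L * (\<Sum>i<n. r i - l i)" by (simp add: sum_distrib_left)
    also have "\<dots> < L * (e / L)" using H L by (intro mult_strict_left_mono) auto
    finally show "(\<Sum>i<n. dist (f (r i)) (f (l i))) < e" using L by simp
  qed
qed

lemma abs_cont_on_C1:
  fixes f :: "real \<Rightarrow> 'b::real_normed_vector"
  assumes f: "\<And>s. s \<in> {a..b} \<Longrightarrow> (f has_vector_derivative f' s) (at s within {a..b})"
    and f': "continuous_on {a..b} f'"
  shows "abs_cont_on a b f"
proof -
  have "bounded (f' ` {a..b})"
    by (intro compact_imp_bounded compact_continuous_image f') simp
  then obtain L where L: "L > 0" "\<And>s. s \<in> {a..b} \<Longrightarrow> norm (f' s) \<le> L"
    unfolding bounded_pos by auto
  show ?thesis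
  proof (rule abs_cont_on_Lipschitz[OF L(1)])
    fix s t assume st: "a \<le> s" "s \<le> t" "t \<le> b"
    have "norm (f t - f s) \<le> L * norm (t - s)"
    proof (rule differentiable_bound[of "{a..b}" f "\<lambda>s h. h *\<^sub>R f' s"])
      fix r assume r: "r \<in> {a..b}"
      show "(f has_derivative (\<lambda>h. h *\<^sub>R f' r)) (at r within {a..b})"
        using f[OF r] by (simp add: has_vector_derivative_def)
      show "onorm (\<lambda>h. h *\<^sub>R f' r) \<le> L"
        using L(2)[OF r] by (intro onorm_le) (simp add: mult.commute[of L] mult_left_mono)
    qed (use st in auto)
    then show "dist (f t) (f s) \<le> L * (t - s)" using st by (simp add: dist_norm)
  qed
qed

lemma curve_length_nonneg: "0 \<le> curve_length \<gamma>"
  unfolding curve_length_def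
  \<comment> \<open>\<open>integral\<close> is 0 by default for a nonintegrable speed, which is why
    that case is split off.\<close>
  by (cases "(\<lambda>s. norm (vector_derivative (\<lambda>r. fst (\<gamma> r)) (at s within {0..1}))) integrable_on {0..1}")
    (simp_all add: integral_nonneg not_integrable_integral)

text \<open>The given curve makes the set of lengths nonempty and 0 bounds it below, so its infimum
  is meaningful; nonnegativity is what later permits squaring.\<close>

lemma cc_dist_le_curve_length:
  assumes "horizontal Us \<gamma>" "\<gamma> 0 = (0, 0)" "\<gamma> 1 = g"
  shows "0 \<le> cc_dist Us g" "cc_dist Us g \<le> curve_length \<gamma>"
proof -
  let ?S = "{curve_length \<gamma> | \<gamma>. horizontal Us \<gamma> \<and> \<gamma> 0 = (0, 0) \<and> \<gamma> 1 = g}"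
  have mem: "curve_length \<gamma> \<in> ?S" using assms by blast
  have low: "\<And>l. l \<in> ?S \<Longrightarrow> 0 \<le> l" using curve_length_nonneg by auto
  show "0 \<le> cc_dist Us g"
    unfolding cc_dist_def using mem low by (intro cInf_greatest) blast+
  show "cc_dist Us g \<le> curve_length \<gamma>"
    unfolding cc_dist_def using mem low by (intro cInf_lower bdd_belowI[of _ 0])
qed

section \<open>Criticality of the parameter, and the end points, horizontality and length of the
  curve\<close>

theorem theorem2p5:
  fixes Us :: "'m::finite \<Rightarrow> real^'q::finite^'q"
    and x0 :: "real^'q" and \<theta>0 :: "real^'m"
    and xc :: "real \<Rightarrow> real^'q" and \<zeta> :: "real \<Rightarrow> real^'q"
    and tc :: "real \<Rightarrow> real^'m"
  assumes skew: "\<And>j. transpose (Us j) = - Us j"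
    and lin_indep: "\<And>c. (\<Sum>j\<in>UNIV. c j *\<^sub>R Us j) = 0 \<Longrightarrow> (\<forall>j. c j = 0)"
    and x0: "x0 \<noteq> 0"
    and \<theta>0: "\<theta>0 \<in> calV Us"
    and xc_def: "\<And>s. xc s = Uapply Us (sin_ratio s) \<theta>0 (mexp ((s - 1) *\<^sub>R Ut Us \<theta>0) *v x0)"
    and \<zeta>_def: "\<And>s. \<zeta> s = Uapply Us z_over_sin \<theta>0 (mexp ((2 * s - 1) *\<^sub>R Ut Us \<theta>0) *v x0)"
    and tc_def: "\<And>s. tc s = (1/2) *\<^sub>R integral {0..s} (\<lambda>r. UU Us (xc r) (\<zeta> r))"
  shows "(\<forall>t0. ((\<lambda>\<theta>. phi Us (x0, t0) \<theta>) has_derivative (\<lambda>h. 0)) (at \<theta>0) \<longrightarrow>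
            horizontal Us (\<lambda>s. (xc s, tc s)) \<and>
            (xc 0, tc 0) = (0, 0) \<and> (xc 1, tc 1) = (x0, t0) \<and>
            (cc_dist Us (x0, t0))\<^sup>2 \<le> (curve_length (\<lambda>s. (xc s, tc s)))\<^sup>2 \<and>
            (curve_length (\<lambda>s. (xc s, tc s)))\<^sup>2 = (norm (Uapply Us z_over_sin \<theta>0 x0))\<^sup>2 \<and>
            (norm (Uapply Us z_over_sin \<theta>0 x0))\<^sup>2 = phi Us (x0, t0) \<theta>0)
       \<and> ((\<lambda>\<theta>. phi Us (x0, tc 1) \<theta>) has_derivative (\<lambda>h. 0)) (at \<theta>0)"
proof -
  have A: "transpose (Ut Us \<theta>0) = - Ut Us \<theta>0" by (rule Ut_skew[OF skew])
  have nr: "nonresonant (Ut Us \<theta>0)" by (rule calV_nonresonant[OF \<theta>0])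
  have xc: "xc = geo_point Us \<theta>0 x0" by (simp add: fun_eq_iff xc_def geo_point_def)
  have ze: "\<zeta> = geo_velocity Us \<theta>0 x0" by (simp add: fun_eq_iff \<zeta>_def geo_velocity_def)
  have T: "tc 1 = (1/2) *\<^sub>R integral {0..1} (\<lambda>s. UU Us (geo_point Us \<theta>0 x0 s) (geo_velocity Us \<theta>0 x0 s))"
    unfolding tc_def xc ze ..
  \<comment> \<open>One gradient formula serves both directions: it vanishes exactly when
    \<open>t\<close> equals \<open>tc 1\<close>.\<close>
  have dphi: "((\<lambda>\<theta>. phi Us (x0, t) \<theta>) has_derivative (\<lambda>h. 4 * ((t - tc 1) \<bullet> h))) (at \<theta>0)" for t
    by (rule phi_has_derivative[OF skew nr T])
  define t' where "t' s = (1/2) *\<^sub>R UU Us (xc s) (\<zeta> s)" for s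
  have cont: "continuous_on {0..1} xc" "continuous_on {0..1} \<zeta>"
    unfolding xc ze by (rule geo_continuous[OF A nr])+
  then have cont_UU: "continuous_on {0..1} (\<lambda>s. UU Us (xc s) (\<zeta> s))" by (rule continuous_on_UU)
  then have cont_t': "continuous_on {0..1} t'" unfolding t'_def by (intro continuous_intros)
  have dx: "(xc has_vector_derivative \<zeta> s) (at s)" for s
    unfolding xc ze by (rule geo_point_derivative[OF A nr])
  have dt: "(tc has_vector_derivative t' s) (at s within {0..1})" if "s \<in> {0..1}" for s
    unfolding t'_def tc_def[abs_def]
    by (intro bounded_linear.has_vector_derivative[OF bounded_linear_scaleR_right]
        integral_has_vector_derivative[OF cont_UU that])
  have hor: "horizontal Us (\<lambda>s. (xc s, tc s))"
    unfolding horizontal_def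
  proof
    show "abs_cont_on 0 1 (\<lambda>s. (xc s, tc s))"
    proof (rule abs_cont_on_C1)
      show "continuous_on {0..1} (\<lambda>s. (\<zeta> s, t' s))" by (intro continuous_on_Pair cont cont_t')
      fix s :: real assume "s \<in> {0..1}"
      then show "((\<lambda>s. (xc s, tc s)) has_vector_derivative (\<zeta> s, t' s)) (at s within {0..1})"
        by (intro has_vector_derivative_Pair dt has_vector_derivative_at_within[OF dx])
    qed
    show "AE s in lborel. s \<in> {0..1} \<longrightarrow>
        (\<exists>x' t'. ((\<lambda>r. fst (xc r, tc r)) has_vector_derivative x') (at s within {0..1}) \<and>
                 ((\<lambda>r. snd (xc r, tc r)) has_vector_derivative t') (at s within {0..1}) \<and>
                 t' = (1/2) *\<^sub>R UU Us (fst (xc s, tc s)) x')"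
    proof (intro AE_I2 impI)
      fix s :: real assume s: "s \<in> {0..1}"
      show "\<exists>x' t'. ((\<lambda>r. fst (xc r, tc r)) has_vector_derivative x') (at s within {0..1}) \<and>
                 ((\<lambda>r. snd (xc r, tc r)) has_vector_derivative t') (at s within {0..1}) \<and>
                 t' = (1/2) *\<^sub>R UU Us (fst (xc s, tc s)) x'"
        using has_vector_derivative_at_within[OF dx] dt[OF s] unfolding fst_conv snd_conv t'_def by blast
    qed
  qed
  have start: "(xc 0, tc 0) = (0, 0)" by (simp add: xc geo_point_0[OF A nr] tc_def)
  have x1: "xc 1 = x0" by (simp add: xc geo_point_1[OF A nr])
  let ?N = "norm (Uapply Us z_over_sin \<theta>0 x0)"
  have len: "curve_length (\<lambda>s. (xc s, tc s)) = ?N"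
  proof -
    have "norm (vector_derivative xc (at s within {0..1})) = ?N" if "s \<in> {0..1}" for s
    proof -
      have "vector_derivative xc (at s within {0..1}) = \<zeta> s"
        using that dx by (intro vector_derivative_at_within_ivl[of _ _ _ 0 1]) auto
      then show ?thesis
        using skew_flow_norm[OF A geo_velocity_derivative[OF A], of x0 s "1/2"]
        by (simp add: ze geo_velocity_half[OF A])
    qed
    then have "integral {0..1} (\<lambda>s. norm (vector_derivative xc (at s within {0..1}))) = integral {0..1} (\<lambda>s::real. ?N)"
      by (rule integral_cong)
    then show ?thesis by (simp add: curve_length_def)
  qed
  show ?thesis
  proof (intro conjI allI impI)
    fix t0 assume crit: "((\<lambda>\<theta>. phi Us (x0, t0) \<theta>) has_derivative (\<lambda>h. 0)) (at \<theta>0)"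
    \<comment> \<open>Uniqueness of the derivative; evaluation at \<open>t0 - tc 1\<close> then
      gives a vanishing squared norm.\<close>
    have "(\<lambda>h. 4 * ((t0 - tc 1) \<bullet> h)) = (\<lambda>h. 0)"
      by (rule has_derivative_unique[OF dphi crit])
    from fun_cong[OF this, of "t0 - tc 1"] have t0: "t0 = tc 1" by simp
    show "horizontal Us (\<lambda>s. (xc s, tc s))" by (rule hor)
    show "(xc 0, tc 0) = (0, 0)" by (rule start)
    show "(xc 1, tc 1) = (x0, t0)" by (simp add: x1 t0)
    show "(cc_dist Us (x0, t0))\<^sup>2 \<le> (curve_length (\<lambda>s. (xc s, tc s)))\<^sup>2"
      using cc_dist_le_curve_length[OF hor start, of "(x0, t0)"] by (intro power_mono) (simp_all add: x1 t0)
    show "(curve_length (\<lambda>s. (xc s, tc s)))\<^sup>2 = ?N\<^sup>2" by (simp add: len)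
    show "?N\<^sup>2 = phi Us (x0, t0) \<theta>0"
      unfolding t0 by (rule phi_eq_velocity_norm[OF skew nr T, symmetric])
  next
    show "((\<lambda>\<theta>. phi Us (x0, tc 1) \<theta>) has_derivative (\<lambda>h. 0)) (at \<theta>0)"
      using dphi[of "tc 1"] by simp
  qed
qed

end
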